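(* Let $\overline{x}\in\mathbb{X}$ be a stationary point of the nonlinear semidefinite program (NLSDP) $\min f(x)$ s.t. $h(x)=0$, $g(x)\in\mathbb{S}^n_+$, with a Lagrange multiplier $(\overline\xi,\overline\Gamma)\in M(\overline{x})$, and let $F$ be the associated KKT residual mapping. (i) If there is a nonsingular element $\overline{\mathcal U}\in\partial_CF(\overline x,\overline\xi,\overline\Gamma)$, then the weak strict Robinson constraint qualification (W-SRCQ) holds at $(\overline x,\overline\xi,\overline\Gamma)$. (ii) If the NLSDP is convex (i.e., $f$ is convex, $h$ is affine and $g$ is $\mathbb{S}^n_+$-convex) and there is a nonsingular element $\overline{\mathcal U}\in\partial_CF(\overline x,\overline\xi,\overline\Gamma)$, then the W-SRCQ and the weak second order condition (W-SOC) hold at $(\overline x,\overline\xi,\overline\Gamma)$.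
   Context: Setting. $\mathbb{X}$ is a finite-dimensional real Euclidean space; $\mathbb{S}^n$ is the space of real symmetric $n\times n$ matrices with the trace inner product, $\mathbb{S}^n_+$ the positive semidefinite cone. The functions $f:\mathbb{X}\to\mathbb{R}$, $h:\mathbb{X}\to\mathbb{R}^m$, $g:\mathbb{X}\to\mathbb{S}^n$ are twice continuously differentiable. "$g$ is $\mathbb{S}^n_+$-convex" means $g(tx+(1-t)y)-tg(x)-(1-t)g(y)\in\mathbb{S}^n_+$ for all $x,y\in\mathbb{X}$, $t\in(0,1)$. $L(x,\xi,\Gamma)=f(x)+\langle\xi,h(x)\rangle+\langle\Gamma,g(x)\rangle$. Put $\mathbb{Z}=\mathbb{X}\times\mathbb{R}^m\times\mathbb{S}^n$. A KKT point is $(x,\xi,\Gamma)\in\mathbb{Z}$ with $\nabla_xL(x,\xi,\Gamma)=0$, $h(x)=0$, $\Gamma\in\mathcal{N}_{\mathbb{S}^n_+}(g(x))$ (normal cone of convex analysis). $M(x)$ is the set of $(\xi,\Gamma)$ such that $(x,\xi,\Gamma)$ is a KKT point; a feasible $x$ is stationary if $M(x)\ne\emptyset$. With $\Pi_{\mathbb{S}^n_+}$ the metric projection onto $\mathbb{S}^n_+$, the KKT residual mapping $F:\mathbb{Z}\to\mathbb{Z}$ is $F(x,\xi,\Gamma)=\big(\nabla_xL(x,\xi,\Gamma),\,h(x),\,-g(x)+\Pi_{\mathbb{S}^n_+}(g(x)+\Gamma)\big)$. It is locally Lipschitz; $\partial_BF(Z)$ denotes the set of all limits of $F'(Z^k)$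 with $Z^k\to Z$, $F$ differentiable at $Z^k$, and $\partial_CF(Z)$ is the convex hull of $\partial_BF(Z)$. A linear operator is nonsingular if it is invertible. Eigenvalue notation. Let $A=g(\overline x)+\overline\Gamma=\overline P\,\mathrm{Diag}(\overline\lambda)\overline P^T$ with $\overline P$ orthogonal and $\overline\lambda$ the eigenvalues in nonincreasing order; $\alpha=\{i:\overline\lambda_i>0\}$, $\beta=\{i:\overline\lambda_i=0\}$, $\gamma=\{i:\overline\lambda_i<0\}$. Let $\overline{\mathcal B}(\Delta x)=\overline P^T(g'(\overline x)\Delta x)\overline P$. Conditions. - W-SRCQ: $(h'(\overline x),g'(\overline x))\mathbb{X}+\{0\}\times\{\overline PB\overline P^T:B\in\mathbb{S}^n,\ B_{\beta\gamma}=0,B_{\gamma\gamma}=0\}=\mathbb{R}^m\times\mathbb{S}^n$ (the second summand is $\{0\}\times$ the affine hull of $\mathcal T_{\mathbb{S}^n_+}(g(\overline x))\cap\overline\Gamma^\perp$, with $\mathcal T$ the tangent cone). - W-SOC: $\langle\Delta x,\nabla^2_{xx}L(\overline x,\overline\xi,\overline\Gamma)\Delta x\rangle-2\sum_{i\in\alpha}\sum_{j\in\gamma}\frac{\overline\lambda_j}{\overline\lambda_i}\overline{\mathcal B}(\Delta x)_{ij}^2>0$ for all nonzero $\Delta x\in\mathbb{X}$ with $h'(\overline x)\Delta x=0$, $\overline{\mathcal B}(\Delta x)_{\beta\beta}=0$, $\overline{\mathcal B}(\Delta x)_{\beta\gamma}=0$, $\overline{\mathcal B}(\Delta x)_{\gamma\gamma}=0$.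 *)

theory Defs
  imports "HOL-Analysis.Analysis"
begin

typedef 'n symmat = "{A :: real^'n^('n::finite). transpose A = A}"
  morphisms mat_of Symmat
  by (rule exI[of _ "mat 1"]) simp

setup_lifting type_definition_symmat

lemma mat_of_sym [simp]: "transpose (mat_of A) = mat_of A"
  using mat_of[of A] by simp

lemma mat_of_nth_sym: "mat_of A $ i $ j = mat_of A $ j $ i"
  using mat_of_sym[of A] by (simp add: transpose_def vec_eq_iff)

instantiation symmat :: (finite) real_vector
begin

lift_definition zero_symmat :: "'a symmat" is 0
  by (simp add: transpose_def vec_eq_iff)
lift_definition plus_symmat :: "'a symmat \<Rightarrow> 'a symmat \<Rightarrow> 'a symmat" is "(+)"
  by (simp add: transpose_def vec_eq_iff)
lift_definition minus_symmat :: "'a symmat \<Rightarrow> 'a symmat \<Rightarrow> 'a symmat" is "(-)"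
  by (simp add: transpose_def vec_eq_iff)
lift_definition uminus_symmat :: "'a symmat \<Rightarrow> 'a symmat" is uminus
  by (simp add: transpose_def vec_eq_iff)
lift_definition scaleR_symmat :: "real \<Rightarrow> 'a symmat \<Rightarrow> 'a symmat" is "(*\<^sub>R)"
  by (simp add: transpose_def vec_eq_iff)

instance
  by standard (transfer; simp add: algebra_simps)+

end

instantiation symmat :: (finite) real_inner
begin

definition inner_symmat :: "'a symmat \<Rightarrow> 'a symmat \<Rightarrow> real"
  where "inner_symmat A B = trace (mat_of A ** mat_of B)"
definition norm_symmat :: "'a symmat \<Rightarrow> real"
  where "norm_symmat A = sqrt (inner A A)"
definition dist_symmat :: "'a symmat \<Rightarrow> 'a symmat \<Rightarrow> real"
  where "dist_symmat A B = norm (A - B)"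
definition sgn_symmat :: "'a symmat \<Rightarrow> 'a symmat"
  where "sgn_symmat A = inverse (norm A) *\<^sub>R A"
definition uniformity_symmat :: "('a symmat \<times> 'a symmat) filter"
  where "uniformity_symmat = (INF e\<in>{0<..}. principal {(A, B). dist A B < e})"
definition open_symmat :: "'a symmat set \<Rightarrow> bool"
  where "open_symmat U \<longleftrightarrow> (\<forall>A\<in>U. \<forall>\<^sub>F (A', B) in uniformity. A' = A \<longrightarrow> B \<in> U)"

lemma inner_mat_of: "inner A B = inner (mat_of A) (mat_of B)" for A B :: "'a symmat"
proof -
  have *: "mat_of A $ i $ j * mat_of B $ j $ i = mat_of A $ i $ j * mat_of B $ i $ j" for i j
    using mat_of_nth_sym[of B j i] by simp
  show ?thesis
    by (simp only: inner_symmat_def trace_def matrix_matrix_mult_def inner_vec_def inner_real_def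
        vec_lambda_beta *)
qed

instance
proof
  fix A B C :: "'a symmat" and r :: real
  show "inner A B = inner B A"
    by (simp add: inner_mat_of inner_commute)
  show "inner (A + B) C = inner A C + inner B C"
    by (simp add: inner_mat_of plus_symmat.rep_eq inner_add_left)
  show "inner (r *\<^sub>R A) B = r * inner A B"
    by (simp add: inner_mat_of scaleR_symmat.rep_eq)
  show "0 \<le> inner A A"
    by (simp add: inner_mat_of)
  show "inner A A = 0 \<longleftrightarrow> A = 0"
    by (simp add: inner_mat_of mat_of_inject[symmetric] zero_symmat.rep_eq)
qed (simp_all add: norm_symmat_def dist_symmat_def sgn_symmat_def
    uniformity_symmat_def open_symmat_def)

end

lemma exists_orthonormal_basis_symmat:
  "\<exists>B :: 'n::finite symmat set. B \<noteq> {} \<and> finite B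
     \<and> (\<forall>U\<in>B. \<forall>V\<in>B. inner U V = (if U = V then 1 else 0))
     \<and> (\<forall>A. (\<forall>U\<in>B. inner A U = 0) \<longleftrightarrow> A = 0)"
proof -
  define S where "S = {A :: real^'n^'n. transpose A = A}"
  have sub: "subspace S"
    by (auto simp: S_def subspace_def transpose_def vec_eq_iff)
  obtain B where B: "B \<subseteq> S" "pairwise orthogonal B" "\<And>x. x \<in> B \<Longrightarrow> norm x = 1"
      "independent B" "card B = dim S" "span B = S"
    using orthonormal_basis_subspace[OF sub] by metis
  note S = B(1)[unfolded S_def] B(6)[unfolded S_def]
  let ?C = "Symmat ` B"
  have rep: "mat_of (Symmat b) = b" if "b \<in> B" for b
    using Symmat_inverse[OF subsetD[OF S(1) that]] .
  have ex0: "A = 0" if "\<forall>U\<in>?C. inner A U = 0" for A :: "'n symmat"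
  proof -
    have "orthogonal (mat_of A) b" if "b \<in> B" for b
      using \<open>\<forall>U\<in>?C. inner A U = 0\<close> that by (simp add: inner_mat_of rep orthogonal_def)
    moreover have "mat_of A \<in> span B"
      using S(2) mat_of by simp
    ultimately have "orthogonal (mat_of A) (mat_of A)"
      by (rule orthogonal_to_span[rotated])
    then show ?thesis
      by (simp add: orthogonal_self mat_of_inject[symmetric] zero_symmat.rep_eq)
  qed
  have ne: "?C \<noteq> {}"
  proof
    assume "?C = {}"
    then have "\<forall>U\<in>?C. inner (Symmat (mat 1)) U = 0" by simp
    then have "Symmat (mat 1) = (0 :: 'n symmat)" by (rule ex0)
    then have "mat_of (Symmat (mat 1)) = (0 :: real^'n^'n)" by (simp add: zero_symmat.rep_eq)
    then have "(mat 1 :: real^'n^'n) = 0" by (simp add: Symmat_inverse)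
    then have "(mat 1 :: real^'n^'n) $ i $ i = 0" for i by simp
    then show False by (simp add: mat_def)
  qed
  have on: "inner U V = (if U = V then 1 else 0)" if UV: "U \<in> ?C" "V \<in> ?C" for U V
  proof -
    obtain u v where uv: "u \<in> B" "v \<in> B" "U = Symmat u" "V = Symmat v" using UV by blast
    have eq: "U = V \<longleftrightarrow> u = v" using uv rep by metis
    have "inner U V = inner u v" using uv by (simp add: inner_mat_of rep)
    moreover have "inner u u = 1" using B(3)[OF uv(1)] by (simp add: norm_eq_1)
    moreover have "u \<noteq> v \<Longrightarrow> inner u v = 0"
      using B(2) uv(1,2) by (simp add: pairwise_def orthogonal_def)
    ultimately show ?thesis using eq by (cases "u = v") simp_all
  qed
  have "finite ?C" using independent_imp_finite[OF B(4)] by simp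
  moreover have "\<forall>A. (\<forall>U\<in>?C. inner A U = 0) \<longleftrightarrow> A = 0"
  proof (intro allI iffI)
    fix A :: "'n symmat"
    assume "\<forall>U\<in>?C. inner A U = 0"
    then show "A = 0" by (rule ex0)
  qed simp
  ultimately have "?C \<noteq> {} \<and> finite ?C
      \<and> (\<forall>U\<in>?C. \<forall>V\<in>?C. inner U V = (if U = V then 1 else 0))
      \<and> (\<forall>A. (\<forall>U\<in>?C. inner A U = 0) \<longleftrightarrow> A = 0)"
    using ne on by (intro conjI ballI) simp_all
  then show ?thesis by (rule exI)
qed

instantiation symmat :: (finite) euclidean_space
begin

definition Basis_symmat :: "'a symmat set"
  where "Basis_symmat = (SOME B. B \<noteq> {} \<and> finite B
     \<and> (\<forall>U\<in>B. \<forall>V\<in>B. inner U V = (if U = V then 1 else 0))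
     \<and> (\<forall>A. (\<forall>U\<in>B. inner A U = 0) \<longleftrightarrow> A = 0))"

instance
proof -
  have *: "(Basis :: 'a symmat set) \<noteq> {} \<and> finite (Basis :: 'a symmat set)
     \<and> (\<forall>U\<in>Basis. \<forall>V\<in>Basis. inner U (V :: 'a symmat) = (if U = V then 1 else 0))
     \<and> (\<forall>A :: 'a symmat. (\<forall>U\<in>Basis. inner A U = 0) \<longleftrightarrow> A = 0)"
    unfolding Basis_symmat_def by (rule someI_ex) (rule exists_orthonormal_basis_symmat)
  show "OFCLASS('a symmat, euclidean_space_class)"
  proof
    show "(Basis :: 'a symmat set) \<noteq> {}" "finite (Basis :: 'a symmat set)"
      using * by blast+
    show "inner U V = (if U = V then 1 else 0)" if "U \<in> Basis" "V \<in> Basis" for U V :: "'a symmat"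
      using * that by blast
    show "(\<forall>U\<in>Basis. inner A U = 0) \<longleftrightarrow> A = 0" for A :: "'a symmat"
      using * by blast
  qed
qed

end

definition psd_cone :: "'n::finite symmat set"
  where "psd_cone = {A. \<forall>v. 0 \<le> inner v (mat_of A *v v)}"

definition twice_continuously_differentiable ::
    "('a::real_normed_vector \<Rightarrow> 'b::real_normed_vector) \<Rightarrow> bool"
  where "twice_continuously_differentiable f \<longleftrightarrow>
    (\<exists>(f' :: 'a \<Rightarrow> 'a \<Rightarrow>\<^sub>L 'b) (f'' :: 'a \<Rightarrow> 'a \<Rightarrow>\<^sub>L ('a \<Rightarrow>\<^sub>L 'b)).
       (\<forall>x. (f has_derivative blinfun_apply (f' x)) (at x)) \<and>
       (\<forall>x. (f' has_derivative blinfun_apply (f'' x)) (at x)) \<and>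
       continuous_on UNIV f'')"

definition gradient :: "('a::euclidean_space \<Rightarrow> real) \<Rightarrow> 'a \<Rightarrow> 'a"
  where "gradient f x = (THE D. GDERIV f x :> D)"

definition hessian :: "('a::euclidean_space \<Rightarrow> real) \<Rightarrow> 'a \<Rightarrow> 'a \<Rightarrow> 'a"
  where "hessian f x = frechet_derivative (gradient f) (at x)"

definition B_subdifferential ::
    "('a::euclidean_space \<Rightarrow> 'b::euclidean_space) \<Rightarrow> 'a \<Rightarrow> ('a \<Rightarrow>\<^sub>L 'b) set"
  where "B_subdifferential F z = {U. \<exists>(Z :: nat \<Rightarrow> 'a) (D :: nat \<Rightarrow> 'a \<Rightarrow>\<^sub>L 'b).
     Z \<longlonglongrightarrow> z \<and> (\<forall>k. (F has_derivative blinfun_apply (D k)) (at (Z k))) \<and> D \<longlonglongrightarrow> U}"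

definition clarke_jacobian ::
    "('a::euclidean_space \<Rightarrow> 'b::euclidean_space) \<Rightarrow> 'a \<Rightarrow> ('a \<Rightarrow>\<^sub>L 'b) set"
  where "clarke_jacobian F z = convex hull (B_subdifferential F z)"

definition nonsingular :: "('a::real_normed_vector \<Rightarrow>\<^sub>L 'b::real_normed_vector) \<Rightarrow> bool"
  where "nonsingular U \<longleftrightarrow> bij (blinfun_apply U)"

definition normal_cone :: "'a::real_inner set \<Rightarrow> 'a \<Rightarrow> 'a set"
  where "normal_cone K y = {v. y \<in> K \<and> (\<forall>z\<in>K. inner v (z - y) \<le> 0)}"

definition lagrangian ::
    "('a \<Rightarrow> real) \<Rightarrow> ('a \<Rightarrow> real^'m) \<Rightarrow> ('a \<Rightarrow> 'n symmat) \<Rightarrow>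
     'a::euclidean_space \<Rightarrow> real^'m \<Rightarrow> 'n::finite symmat \<Rightarrow> real"
  where "lagrangian f h g x \<xi> \<Gamma> = f x + inner \<xi> (h x) + inner \<Gamma> (g x)"

definition KKT_point ::
    "('a \<Rightarrow> real) \<Rightarrow> ('a \<Rightarrow> real^'m) \<Rightarrow> ('a \<Rightarrow> 'n symmat) \<Rightarrow>
     'a::euclidean_space \<times> (real^'m) \<times> 'n::finite symmat \<Rightarrow> bool"
  where "KKT_point f h g = (\<lambda>(x, \<xi>, \<Gamma>).
     gradient (\<lambda>y. lagrangian f h g y \<xi> \<Gamma>) x = 0 \<and> h x = 0 \<and>
     \<Gamma> \<in> normal_cone psd_cone (g x))"

definition multipliers ::
    "('a \<Rightarrow> real) \<Rightarrow> ('a \<Rightarrow> real^'m) \<Rightarrow> ('a \<Rightarrow> 'n symmat) \<Rightarrow>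
     'a::euclidean_space \<Rightarrow> ((real^'m) \<times> 'n::finite symmat) set"
  where "multipliers f h g x = {(\<xi>, \<Gamma>). KKT_point f h g (x, \<xi>, \<Gamma>)}"

definition stationary_point ::
    "('a \<Rightarrow> real) \<Rightarrow> ('a \<Rightarrow> real^'m) \<Rightarrow> ('a \<Rightarrow> 'n::finite symmat) \<Rightarrow>
     'a::euclidean_space \<Rightarrow> bool"
  where "stationary_point f h g x \<longleftrightarrow>
     h x = 0 \<and> g x \<in> psd_cone \<and> multipliers f h g x \<noteq> {}"

definition KKT_residual ::
    "('a \<Rightarrow> real) \<Rightarrow> ('a \<Rightarrow> real^'m) \<Rightarrow> ('a \<Rightarrow> 'n symmat) \<Rightarrow>
     'a::euclidean_space \<times> (real^'m) \<times> 'n::finite symmat \<Rightarrow> 'a \<times> (real^'m) \<times> 'n symmat"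
  where "KKT_residual f h g = (\<lambda>(x, \<xi>, \<Gamma>).
     (gradient (\<lambda>y. lagrangian f h g y \<xi> \<Gamma>) x,
      h x,
      - g x + closest_point psd_cone (g x + \<Gamma>)))"

text \<open>The inequality is reversed compared with the usual Loewner-convexity, so that the set
  where g(x) is positive semidefinite is convex.\<close>

definition psd_convex :: "('a::real_vector \<Rightarrow> 'n::finite symmat) \<Rightarrow> bool"
  where "psd_convex g \<longleftrightarrow> (\<forall>x y. \<forall>t\<in>{0<..<1}.
     g (t *\<^sub>R x + (1 - t) *\<^sub>R y) - t *\<^sub>R g x - (1 - t) *\<^sub>R g y \<in> psd_cone)"

definition convex_NLSDP ::
    "('a \<Rightarrow> real) \<Rightarrow> ('a \<Rightarrow> real^'m) \<Rightarrow> ('a::euclidean_space \<Rightarrow> 'n::finite symmat) \<Rightarrow> bool"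
  where "convex_NLSDP f h g \<longleftrightarrow>
     convex_on UNIV f \<and> (\<exists>A b. linear A \<and> h = (\<lambda>x. A x + b)) \<and> psd_convex g"

definition Diag :: "real^'n \<Rightarrow> real^'n^'n"
  where "Diag v = (\<chi> i j. if i = j then v $ i else 0)"

definition ordered_eigendecomposition ::
    "'n::{finite,linorder} symmat \<Rightarrow>
     real^('n::{finite,linorder})^('n::{finite,linorder}) \<Rightarrow>
     real^('n::{finite,linorder}) \<Rightarrow> bool"
  where "ordered_eigendecomposition A P v \<longleftrightarrow>
     orthogonal_matrix P \<and> antimono (\<lambda>i. v $ i) \<and> mat_of A = P ** Diag v ** transpose P"

definition pos_idx :: "real^'n \<Rightarrow> 'n set" where "pos_idx v = {i. v $ i > 0}"
definition zero_idx :: "real^'n \<Rightarrow> 'n set" where "zero_idx v = {i. v $ i = 0}"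
definition neg_idx :: "real^'n \<Rightarrow> 'n set" where "neg_idx v = {i. v $ i < 0}"

text \<open>In the following conditions, P and v are an orthogonal matrix and the eigenvalues of an
  ordered spectral decomposition of g(x) + \<Gamma>; the multiplier \<Gamma> enters the constraint qualification
  only through them.\<close>

definition W_SRCQ ::
    "('a \<Rightarrow> real^'m) \<Rightarrow> ('a \<Rightarrow> 'n symmat) \<Rightarrow>
     'a::euclidean_space \<Rightarrow> real^'n^'n \<Rightarrow> real^'n::finite \<Rightarrow> bool"
  where "W_SRCQ h g x P v \<longleftrightarrow>
     range (\<lambda>d. (frechet_derivative h (at x) d, frechet_derivative g (at x) d))
     + {0} \<times> {C. \<exists>B :: 'n symmat.
          (\<forall>i\<in>zero_idx v. \<forall>j\<in>neg_idx v. mat_of B $ i $ j = 0) \<and>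
          (\<forall>i\<in>neg_idx v. \<forall>j\<in>neg_idx v. mat_of B $ i $ j = 0) \<and>
          mat_of C = P ** mat_of B ** transpose P}
     = (UNIV :: ((real^'m) \<times> 'n symmat) set)"

definition rotated_derivative ::
    "('a \<Rightarrow> 'n symmat) \<Rightarrow> 'a::euclidean_space \<Rightarrow> real^'n^'n \<Rightarrow> 'a \<Rightarrow> real^'n^'n::finite"
  where "rotated_derivative g x P d =
     transpose P ** mat_of (frechet_derivative g (at x) d) ** P"

definition W_SOC ::
    "('a \<Rightarrow> real) \<Rightarrow> ('a \<Rightarrow> real^'m) \<Rightarrow> ('a \<Rightarrow> 'n symmat) \<Rightarrow>
     'a::euclidean_space \<Rightarrow> real^'m \<Rightarrow> 'n::finite symmat \<Rightarrow> real^'n^'n \<Rightarrow> real^'n \<Rightarrow> bool"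
  where "W_SOC f h g x \<xi> \<Gamma> P v \<longleftrightarrow>
     (\<forall>d. d \<noteq> 0 \<longrightarrow>
        frechet_derivative h (at x) d = 0 \<longrightarrow>
        (\<forall>i\<in>zero_idx v. \<forall>j\<in>zero_idx v. rotated_derivative g x P d $ i $ j = 0) \<longrightarrow>
        (\<forall>i\<in>zero_idx v. \<forall>j\<in>neg_idx v. rotated_derivative g x P d $ i $ j = 0) \<longrightarrow>
        (\<forall>i\<in>neg_idx v. \<forall>j\<in>neg_idx v. rotated_derivative g x P d $ i $ j = 0) \<longrightarrow>
        inner d (hessian (\<lambda>y. lagrangian f h g y \<xi> \<Gamma>) x d)
        - 2 * (\<Sum>i\<in>pos_idx v. \<Sum>j\<in>neg_idx v.
                 v $ j / v $ i * (rotated_derivative g x P d $ i $ j)\<^sup>2) > 0)"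

end

theory Submission
  imports Defs
begin

text \<open>
Let \<open>\<Pi>\<close> be the projection onto the cone, \<open>A = g x + \<Gamma>\<close>, \<open>Y = \<Pi> A\<close> and \<open>Z = Y - A\<close>. Every element \<open>V\<close> of
the generalized Jacobian of \<open>\<Pi>\<close> at \<open>A\<close> satisfies \<open>V (K Y + Y K' + K' Z + Z K) = K Y + Y K'\<close> for all
matrices \<open>K\<close> (with \<open>K'\<close> the transpose): at points of differentiability this comes from
differentiating the projection along a curve whose positive and negative parts are congruent to
\<open>Y\<close> and \<open>Z\<close>, and the relation survives limits and convex combinations. In the eigenbasis of \<open>A\<close> a
suitable \<open>K\<close> gives \<open>V H = 0\<close> when \<open>H\<close> lives on the blocks \<open>\<beta>\<gamma>\<close>, \<open>\<gamma>\<gamma>\<close>, and \<open>V H = H\<close> when it lives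
on the blocks \<open>\<alpha>\<alpha>\<close>, \<open>\<alpha>\<beta>\<close>.

If W-SRCQ fails, a nonzero \<open>(\<eta>, \<Theta>)\<close> orthogonal to the left-hand side has \<open>\<Theta>\<close> on the blocks
\<open>\<beta>\<gamma>\<close>, \<open>\<gamma>\<gamma>\<close>, so \<open>(0, \<eta>, \<Theta>)\<close> is in the kernel of \<open>U\<close>. In the convex case both terms of
the second order condition are nonnegative; if it fails at \<open>d\<close>, the Hessian annihilates \<open>d\<close> and
\<open>g' x d\<close> lives on the blocks \<open>\<alpha>\<alpha>\<close>, \<open>\<alpha>\<beta>\<close>, so \<open>(d, 0, 0)\<close> is in the kernel of \<open>U\<close>.
\<close>

section \<open>Differentiating the projection onto the positive semidefinite cone\<close>

lemma inner_matrix_mul_left: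
  fixes A B C :: "real^'n^'n"
  shows "inner (A ** B) C = inner B (transpose A ** C)"
proof -
  have "inner (A ** B) C = (\<Sum>i\<in>UNIV. \<Sum>j\<in>UNIV. \<Sum>k\<in>UNIV. A $ i $ k * B $ k $ j * C $ i $ j)"
    by (simp add: inner_vec_def matrix_matrix_mult_def sum_distrib_right)
  also have "\<dots> = (\<Sum>i\<in>UNIV. \<Sum>k\<in>UNIV. \<Sum>j\<in>UNIV. A $ i $ k * B $ k $ j * C $ i $ j)"
    by (intro sum.cong refl sum.swap)
  also have "\<dots> = (\<Sum>k\<in>UNIV. \<Sum>i\<in>UNIV. \<Sum>j\<in>UNIV. A $ i $ k * B $ k $ j * C $ i $ j)"
    by (rule sum.swap)
  also have "\<dots> = (\<Sum>k\<in>UNIV. \<Sum>j\<in>UNIV. \<Sum>i\<in>UNIV. A $ i $ k * B $ k $ j * C $ i $ j)"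
    by (intro sum.cong refl sum.swap)
  also have "\<dots> = inner B (transpose A ** C)"
    by (simp add: inner_vec_def matrix_matrix_mult_def transpose_def sum_distrib_left mult_ac)
  finally show ?thesis .
qed

lemma transpose_add: "transpose (A + B) = transpose A + transpose (B :: 'a::plus^'n^'m)"
  by (simp add: transpose_def vec_eq_iff)

lemma inner_transpose: "inner (transpose A) (transpose B) = inner A (B :: real^'n^'m)"
  unfolding inner_vec_def transpose_def by (simp, rule sum.swap)

lemma inner_matrix_mul_right:
  fixes A B C :: "real^'n^'n"
  shows "inner (B ** A) C = inner B (C ** transpose A)"
proof -
  have "inner (B ** A) C = inner (transpose A ** transpose B) (transpose C)"
    using inner_transpose[of "B ** A" C] by (simp add: matrix_transpose_mul)
  also have "\<dots> = inner (transpose B) (transpose (C ** transpose A))"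
    by (simp add: inner_matrix_mul_left matrix_transpose_mul)
  finally show ?thesis by (simp add: inner_transpose)
qed

lift_definition congruence :: "real^'n^'n \<Rightarrow> 'n::finite symmat \<Rightarrow> 'n symmat"
  is "\<lambda>S A. S ** A ** transpose S"
  by (simp add: matrix_transpose_mul matrix_mul_assoc)

text \<open>The velocity at \<open>t = 0\<close> of the curve
  \<open>congruence (mat 1 + t *\<^sub>R K) A\<close>; the full expansion is
  \<open>congruence_add_mat_1\<close>.\<close>

lift_definition lyapunov :: "real^'n^'n \<Rightarrow> 'n::finite symmat \<Rightarrow> 'n symmat"
  is "\<lambda>K A. K ** A + A ** transpose K"
  by (simp add: matrix_transpose_mul transpose_add add.commute)

lemma inner_congruence:
  "inner (congruence S A) B = inner A (congruence (transpose S) B)"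
  by (simp only: inner_mat_of congruence.rep_eq inner_matrix_mul_left[of S]
      inner_matrix_mul_right[of _ "transpose S"]
      transpose_transpose matrix_mul_assoc)

lemma congruence_congruence: "congruence S (congruence T A) = congruence (S ** T) A"
  by transfer (simp add: matrix_transpose_mul matrix_mul_assoc)

lemma congruence_mat_1 [simp]: "congruence (mat 1) A = A"
  by transfer simp

lemma matrix_add_rdistrib: "(A + B) ** C = A ** C + B ** (C :: 'a::semiring_1^'n^'m)"
  by (vector matrix_matrix_mult_def sum.distrib distrib_right)

lemma congruence_add_mat_1:
  "congruence (mat 1 + t *\<^sub>R K) A = A + t *\<^sub>R lyapunov K A + t\<^sup>2 *\<^sub>R congruence K A"
proof (transfer fixing: t K)
  fix A :: "real^'a^'a"
  show "(mat 1 + t *\<^sub>R K) ** A ** transpose (mat 1 + t *\<^sub>R K)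
      = A + t *\<^sub>R (K ** A + A ** transpose K) + t\<^sup>2 *\<^sub>R (K ** A ** transpose K)"
    by (simp add: transpose_add transpose_scalar matrix_add_ldistrib matrix_add_rdistrib
        scaleR_right_distrib power2_eq_square matrix_scalar_ac add_ac flip: scalar_matrix_assoc)
qed

lemma bounded_linear_congruence: "bounded_linear (congruence S)"
  unfolding linear_conv_bounded_linear[symmetric]
proof (rule linearI; transfer fixing: S)
  fix A B :: "real^'a^'a" and c :: real
  show "S ** (A + B) ** transpose S = S ** A ** transpose S + S ** B ** transpose S"
    by (simp add: matrix_add_ldistrib matrix_add_rdistrib)
  show "S ** (c *\<^sub>R A) ** transpose S = c *\<^sub>R (S ** A ** transpose S)"
    by (simp add: matrix_scalar_ac flip: scalar_matrix_assoc)
qed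

lemma bounded_linear_lyapunov: "bounded_linear (lyapunov K)"
  unfolding linear_conv_bounded_linear[symmetric]
proof (rule linearI; transfer fixing: K)
  fix A B :: "real^'a^'a" and c :: real
  show "K ** (A + B) + (A + B) ** transpose K
      = K ** A + A ** transpose K + (K ** B + B ** transpose K)"
    by (simp add: matrix_add_ldistrib matrix_add_rdistrib)
  show "K ** (c *\<^sub>R A) + c *\<^sub>R A ** transpose K = c *\<^sub>R (K ** A + A ** transpose K)"
    by (simp add: matrix_scalar_ac scaleR_right_distrib flip: scalar_matrix_assoc)
qed

section \<open>The cone, its metric projection and complementarity\<close>

lemma psd_cone_congruence:
  assumes "A \<in> psd_cone"
  shows "congruence S A \<in> psd_cone"
proof -
  have "inner v (mat_of (congruence S A) *v v)
      = inner (transpose S *v v) (mat_of A *v (transpose S *v v))" for v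
    by (simp add: congruence.rep_eq dot_lmul_matrix matrix_vector_mul_assoc matrix_mul_assoc
        del: transpose_matrix_vector) (simp add: dot_lmul_matrix matrix_vector_mul_assoc matrix_mul_assoc)
  then show ?thesis
    using assms unfolding psd_cone_def by simp
qed

lemma closed_psd_cone: "closed (psd_cone :: 'n::finite symmat set)"
proof -
  have "bounded_linear (\<lambda>A :: 'n symmat. inner v (mat_of A *v v))" for v :: "real^'n"
    unfolding linear_conv_bounded_linear[symmetric]
    by (rule linearI) (simp_all add: plus_symmat.rep_eq scaleR_symmat.rep_eq
        matrix_vector_mult_add_rdistrib inner_add_right flip: scaleR_matrix_vector_assoc)
  then show ?thesis
    unfolding psd_cone_def
    by (intro closed_Collect_all closed_Collect_le continuous_on_const linear_continuous_on)
qed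

lemma convex_psd_cone: "convex (psd_cone :: 'n::finite symmat set)"
  by (rule convexI) (simp add: psd_cone_def plus_symmat.rep_eq scaleR_symmat.rep_eq
      matrix_vector_mult_add_rdistrib inner_add_right flip: scaleR_matrix_vector_assoc)

lemma zero_in_psd_cone: "0 \<in> psd_cone"
  by (simp add: psd_cone_def zero_symmat.rep_eq)

lemma scaleR_psd_cone: "0 \<le> c \<Longrightarrow> A \<in> psd_cone \<Longrightarrow> c *\<^sub>R A \<in> psd_cone"
  by (simp add: psd_cone_def scaleR_symmat.rep_eq flip: scaleR_matrix_vector_assoc)

lemma closest_point_psd_cone_in: "closest_point psd_cone A \<in> psd_cone"
  using closest_point_in_set closed_psd_cone zero_in_psd_cone by blast

text \<open>Stability of the Moreau decomposition: for \<open>Y\<close> in the cone and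
  \<open>Z\<close> in its dual, the complementarity gap \<open>inner Z Y\<close> controls how far
  the projection of \<open>Y - Z\<close> is from \<open>Y\<close>. The obtuse angle property bounds
  the squared distance by \<open>inner Z (Y - p)\<close>, where \<open>p\<close> is the projection,
  and \<open>inner Z p\<close> is nonnegative.\<close>

lemma norm_closest_point_psd_cone_diff:
  assumes "Y \<in> psd_cone" and "\<And>W. W \<in> psd_cone \<Longrightarrow> 0 \<le> inner Z W"
  shows "(norm (closest_point psd_cone (Y - Z) - Y))\<^sup>2 \<le> inner Z Y"
proof -
  define p where "p = closest_point psd_cone (Y - Z)"
  have "inner (Y - Z - p) (Y - p) \<le> 0"
    unfolding p_def by (rule closest_point_dot[OF convex_psd_cone closed_psd_cone assms(1)])
  moreover have "0 \<le> inner Z p"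
    unfolding p_def by (intro assms(2) closest_point_psd_cone_in)
  ultimately show ?thesis
    unfolding p_def[symmetric] power2_norm_eq_inner
    by (simp add: inner_diff_left inner_diff_right inner_commute)
qed

lemma closest_point_psd_cone_moreau:
  fixes A :: "'n::finite symmat"
  defines "Y \<equiv> closest_point psd_cone A"
  shows "inner (Y - A) Y = 0" and "W \<in> psd_cone \<Longrightarrow> 0 \<le> inner (Y - A) W"
proof -
  have dot: "inner (A - Y) (W - Y) \<le> 0" if "W \<in> psd_cone" for W
    unfolding Y_def by (rule closest_point_dot[OF convex_psd_cone closed_psd_cone that])
  \<comment> \<open>The points \<open>2 *\<^sub>R Y\<close> and \<open>0\<close> on the ray through
    \<open>Y\<close> give the two opposite inequalities for \<open>inner (Y - A) Y\<close>.\<close>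
  have "2 *\<^sub>R Y \<in> psd_cone"
    unfolding Y_def by (intro scaleR_psd_cone closest_point_psd_cone_in) simp
  from dot[OF this] dot[OF zero_in_psd_cone] show *: "inner (Y - A) Y = 0"
    by (simp add: inner_diff_left inner_diff_right inner_commute)
  show "0 \<le> inner (Y - A) W" if "W \<in> psd_cone"
    using dot[OF that] * by (simp add: inner_diff_left inner_diff_right inner_commute)
qed

lemma nonneg_quadratic_imp_linear_coeff_zero:
  fixes b c :: real
  assumes "\<And>s. 0 \<le> s * b + s\<^sup>2 * c"
  shows "b = 0"
proof (rule ccontr)
  assume "b \<noteq> 0"
  \<comment> \<open>This \<open>s\<close> makes
    \<open>s * b + s\<^sup>2 * (1 + \<bar>c\<bar>)\<close> vanish; since
    \<open>c < 1 + \<bar>c\<bar>\<close>, the original quadratic is strictly negative there.\<close>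
  define s where "s = - b / (1 + \<bar>c\<bar>)"
  have "s * b + s\<^sup>2 * c \<le> s * b + s\<^sup>2 * \<bar>c\<bar>"
    by (simp add: mult_left_mono)
  also have "\<dots> < s * b + s\<^sup>2 * (1 + \<bar>c\<bar>)"
    using \<open>b \<noteq> 0\<close> by (simp add: s_def ring_distribs)
  also have "\<dots> = 0"
    by (simp add: s_def power2_eq_square divide_simps)
  finally show False
    using assms[of s] by simp
qed

text \<open>The curve below leaves \<open>Y - Z\<close> with velocity \<open>lyapunov K Y + lyapunov (transpose K) Z\<close>.
  Its two parts stay complementary up to an error of order \<open>t ^ 4\<close>, so its projection is
  \<open>congruence (mat 1 + t *\<^sub>R K) Y\<close> up to an error of order \<open>t\<^sup>2\<close>.\<close>

lemma closest_point_psd_cone_congruence_curve: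
  fixes Y Z :: "'n::finite symmat"
  assumes Y: "Y \<in> psd_cone" and Z: "\<And>W. W \<in> psd_cone \<Longrightarrow> 0 \<le> inner Z W"
    and "inner Z Y = 0"
  shows "(norm (closest_point psd_cone
          (congruence (mat 1 + t *\<^sub>R K) Y - congruence (mat 1 + (-t) *\<^sub>R transpose K) Z)
        - congruence (mat 1 + t *\<^sub>R K) Y))\<^sup>2
      \<le> t ^ 4 * inner Z (congruence (K ** K) Y)"
proof -
  \<comment> \<open>Complementarity to first order: the pairing of \<open>Z\<close> with
    \<open>congruence (mat 1 + s *\<^sub>R M) Y\<close> is nonnegative for all \<open>s\<close> and
    vanishes at \<open>s = 0\<close>, so its linear term is zero.\<close>
  have lin: "inner Z (lyapunov M Y) = 0" for M
  proof (rule nonneg_quadratic_imp_linear_coeff_zero)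
    fix s :: real
    have "0 \<le> inner Z (congruence (mat 1 + s *\<^sub>R M) Y)"
      by (intro Z psd_cone_congruence Y)
    then show "0 \<le> s * inner Z (lyapunov M Y) + s\<^sup>2 * inner Z (congruence M Y)"
      by (simp add: congruence_add_mat_1 inner_add_right \<open>inner Z Y = 0\<close>)
  qed
  let ?S = "mat 1 + t *\<^sub>R K" and ?T = "mat 1 + (-t) *\<^sub>R K"
  have trT: "transpose (mat 1 + (-t) *\<^sub>R transpose K) = ?T"
    by (simp add: transpose_add transpose_scalar del: scaleR_minus_left)
  have mul: "(mat 1 + a *\<^sub>R K) ** (mat 1 + b *\<^sub>R K)
      = mat 1 + (a + b) *\<^sub>R K + (a * b) *\<^sub>R (K ** K)" for a b
    by (simp add: matrix_add_ldistrib matrix_add_rdistrib matrix_scalar_ac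
        scaleR_right_distrib scaleR_left_distrib add_ac mult_ac flip: scalar_matrix_assoc)
  \<comment> \<open>The opposite sign and the transpose in the congruence of \<open>Z\<close> serve
    this cancellation: moved onto \<open>Y\<close>, it leaves no term linear in \<open>t\<close>.
    The remaining term of order \<open>t\<^sup>2\<close> is then removed by
    \<open>lin\<close>.\<close>
  have "?T ** ?S = mat 1 + (- (t\<^sup>2)) *\<^sub>R (K ** K)"
    using mul[of "-t" t] by (simp add: power2_eq_square)
  then have "inner (congruence (mat 1 + (-t) *\<^sub>R transpose K) Z) (congruence ?S Y)
      = inner Z (congruence (mat 1 + (- (t\<^sup>2)) *\<^sub>R (K ** K)) Y)"
    by (simp only: inner_congruence trT congruence_congruence)
  also have "\<dots> = t ^ 4 * inner Z (congruence (K ** K) Y)"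
    unfolding congruence_add_mat_1
    by (simp add: inner_add_right inner_diff_right \<open>inner Z Y = 0\<close> lin)
  finally have eq: "inner (congruence (mat 1 + (-t) *\<^sub>R transpose K) Z) (congruence ?S Y)
      = t ^ 4 * inner Z (congruence (K ** K) Y)" .
  have "(norm (closest_point psd_cone
          (congruence ?S Y - congruence (mat 1 + (-t) *\<^sub>R transpose K) Z) - congruence ?S Y))\<^sup>2
      \<le> inner (congruence (mat 1 + (-t) *\<^sub>R transpose K) Z) (congruence ?S Y)"
  proof (rule norm_closest_point_psd_cone_diff)
    show "congruence ?S Y \<in> psd_cone" by (intro psd_cone_congruence Y)
    show "0 \<le> inner (congruence (mat 1 + (-t) *\<^sub>R transpose K) Z) W" if "W \<in> psd_cone" for W
      unfolding inner_congruence by (intro Z psd_cone_congruence that)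
  qed
  then show ?thesis unfolding eq .
qed

text \<open>Linear in the derivative, so the relation passes to limits and to convex combinations.\<close>

lemma has_derivative_closest_point_psd_cone:
  fixes A :: "'n::finite symmat"
  assumes V: "(closest_point psd_cone has_derivative V) (at A)"
  defines "Y \<equiv> closest_point psd_cone A"
  shows "V (lyapunov K Y + lyapunov (transpose K) (Y - A)) = lyapunov K Y"
proof -
  define Z where "Z = Y - A"
  define X where "X t = congruence (mat 1 + t *\<^sub>R K) Y
      - congruence (mat 1 + (-t) *\<^sub>R transpose K) Z" for t
  define H where "H = lyapunov K Y + lyapunov (transpose K) Z"
  define c where "c = inner Z (congruence (K ** K) Y)"
  have X_eq: "X t = A + t *\<^sub>R H + t\<^sup>2 *\<^sub>R (congruence K Y - congruence (transpose K) Z)" for t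
    unfolding X_def H_def congruence_add_mat_1
    by (simp add: Z_def algebra_simps)
  have X0: "X 0 = A" by (simp add: X_eq)
  have dX: "(X has_derivative (\<lambda>t. t *\<^sub>R H)) (at 0)"
    unfolding X_eq[abs_def] by (auto intro!: derivative_eq_intros)
  have "(closest_point psd_cone has_derivative V) (at (X 0))"
    using V by (simp add: X0)
  from has_derivative_compose[OF dX this]
  have 1: "((\<lambda>t. closest_point psd_cone (X t)) has_derivative (\<lambda>t. V (t *\<^sub>R H))) (at 0)" .
  have Yp: "Y \<in> psd_cone" unfolding Y_def by (rule closest_point_psd_cone_in)
  have Zp: "0 \<le> inner Z W" if "W \<in> psd_cone" for W
    unfolding Z_def Y_def by (rule closest_point_psd_cone_moreau(2)[OF that])
  have ZY: "inner Z Y = 0"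
    unfolding Z_def Y_def by (rule closest_point_psd_cone_moreau(1))
  \<comment> \<open>The projection along \<open>X\<close> is differentiated in two ways: by the
    chain rule, and as an explicit congruence plus the remainder \<open>R\<close>. As
    \<open>R\<close> is of order \<open>t\<^sup>2\<close>, its derivative at \<open>0\<close>
    vanishes, and uniqueness of derivatives compares the results.\<close>
  define R where "R t = closest_point psd_cone (X t) - congruence (mat 1 + t *\<^sub>R K) Y" for t
  have R_le: "norm (R t) \<le> t\<^sup>2 * sqrt c" for t
  proof -
    have "(norm (R t))\<^sup>2 \<le> t ^ 4 * c"
      unfolding R_def X_def c_def by (rule closest_point_psd_cone_congruence_curve[OF Yp Zp ZY])
    then have "norm (R t) \<le> sqrt ((t\<^sup>2)\<^sup>2 * c)"
      by (intro real_le_rsqrt) (simp flip: power_mult)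
    also have "\<dots> = t\<^sup>2 * sqrt c"
      unfolding real_sqrt_mult real_sqrt_abs by simp
    finally show ?thesis .
  qed
  have "R 0 = 0" using R_le[of 0] by simp
  have "((\<lambda>t. norm (R t) / norm t) \<longlongrightarrow> 0) (at 0)"
  proof (rule Lim_null_comparison)
    show "\<forall>\<^sub>F t in at 0. norm (norm (R t) / norm t) \<le> \<bar>t\<bar> * sqrt c"
    proof (intro eventuallyI)
      fix t :: real
      have "norm (norm (R t) / norm t) \<le> (t\<^sup>2 * sqrt c) / \<bar>t\<bar>"
        using R_le[of t] by (simp add: divide_right_mono)
      also have "\<dots> = \<bar>t\<bar> * sqrt c"
        by (cases "t = 0") (simp_all add: power2_eq_square abs_if)
      finally show "norm (norm (R t) / norm t) \<le> \<bar>t\<bar> * sqrt c" .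
    qed
    show "((\<lambda>t. \<bar>t\<bar> * sqrt c) \<longlongrightarrow> 0) (at 0)"
      by (auto intro!: tendsto_eq_intros)
  qed
  then have dR: "(R has_derivative (\<lambda>_. 0)) (at 0)"
    unfolding has_derivative_at by (simp add: \<open>R 0 = 0\<close>)
  have "((\<lambda>t. congruence (mat 1 + t *\<^sub>R K) Y) has_derivative (\<lambda>t. t *\<^sub>R lyapunov K Y)) (at 0)"
    unfolding congruence_add_mat_1 by (auto intro!: derivative_eq_intros)
  from has_derivative_add[OF dR this]
  have 2: "((\<lambda>t. closest_point psd_cone (X t)) has_derivative (\<lambda>t. t *\<^sub>R lyapunov K Y)) (at 0)"
    by (simp add: R_def)
  from has_derivative_unique[OF 1 2] have "V (1 *\<^sub>R H) = 1 *\<^sub>R lyapunov K Y"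
    by metis
  then show ?thesis by (simp add: H_def Z_def)
qed

section \<open>Spectral blocks\<close>

lemma Diag_mul_nth: "(Diag u ** K) $ i $ j = u $ i * K $ i $ j"
  by (simp add: Diag_def matrix_matrix_mult_def if_distrib if_distribR sum.delta cong: if_cong)

lemma mul_Diag_nth: "(K ** Diag u) $ i $ j = K $ i $ j * (u $ j :: real)"
  by (simp add: Diag_def matrix_matrix_mult_def if_distrib if_distribR sum.delta' cong: if_cong)

lift_definition diag_symmat :: "real^'n \<Rightarrow> 'n::finite symmat" is Diag
  by (auto simp: Diag_def transpose_def vec_eq_iff)

lemma mat_of_lyapunov_diag_nth:
  "mat_of (lyapunov K (diag_symmat u)) $ i $ j = K $ i $ j * u $ j + u $ i * K $ j $ i"
  by (simp add: lyapunov.rep_eq diag_symmat.rep_eq Diag_mul_nth mul_Diag_nth transpose_def[of K])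

lemma inner_diag_symmat: "inner (diag_symmat u) W = (\<Sum>i\<in>UNIV. u $ i * mat_of W $ i $ i)"
  by (simp add: inner_symmat_def trace_def diag_symmat.rep_eq Diag_mul_nth)

lemma diag_symmat_psd:
  assumes "\<And>i. 0 \<le> u $ i"
  shows "diag_symmat u \<in> psd_cone"
proof -
  have "(Diag u *v w) $ i = u $ i * w $ i" for w :: "real^'a" and i
    by (simp add: Diag_def matrix_vector_mult_def if_distrib if_distribR sum.delta' cong: if_cong)
  then have "inner w (Diag u *v w) = (\<Sum>i\<in>UNIV. u $ i * (w $ i)\<^sup>2)" for w
    by (simp add: inner_vec_def power2_eq_square mult_ac)
  then show ?thesis
    unfolding psd_cone_def by (simp add: diag_symmat.rep_eq sum_nonneg assms)
qed

lemma psd_cone_diagonal_nonneg: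
  assumes "W \<in> psd_cone"
  shows "0 \<le> mat_of W $ i $ i"
proof -
  have "inner (axis i 1) (mat_of W *v axis i 1) = mat_of W $ i $ i"
    by (simp add: inner_axis' matrix_vector_mult_basis column_def)
  then show ?thesis
    using assms unfolding psd_cone_def by (metis mem_Collect_eq)
qed

text \<open>The spectral positive and negative parts have diagonals with disjoint supports in the
  common eigenbasis. Their complementarity gap is therefore zero, and the bound of
  \<open>norm_closest_point_psd_cone_diff\<close> forces equality.\<close>

lemma closest_point_psd_cone_spectral:
  fixes A :: "'n::finite symmat"
  assumes P: "orthogonal_matrix P" and A: "mat_of A = P ** Diag v ** transpose P"
  shows "closest_point psd_cone A = congruence P (diag_symmat (\<chi> i. max (v $ i) 0))"
    and "closest_point psd_cone A - A = congruence P (diag_symmat (\<chi> i. max (- v $ i) 0))"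
proof -
  let ?Y = "congruence P (diag_symmat (\<chi> i. max (v $ i) 0))"
  let ?Z = "congruence P (diag_symmat (\<chi> i. max (- v $ i) 0))"
  have "diag_symmat (\<chi> i. max (v $ i) 0) - diag_symmat (\<chi> i. max (- v $ i) 0) = diag_symmat v"
    by (simp add: mat_of_inject[symmetric] minus_symmat.rep_eq diag_symmat.rep_eq
        Diag_def vec_eq_iff max_def)
  moreover have "A = congruence P (diag_symmat v)"
    by (simp add: mat_of_inject[symmetric] congruence.rep_eq diag_symmat.rep_eq A)
  ultimately have AYZ: "A = ?Y - ?Z"
    by (simp flip: bounded_linear.linear[OF bounded_linear_congruence, THEN linear_diff])
  have PP: "transpose P ** P = mat 1"
    using P by (simp add: orthogonal_matrix)
  have "(norm (closest_point psd_cone (?Y - ?Z) - ?Y))\<^sup>2 \<le> inner ?Z ?Y"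
  proof (rule norm_closest_point_psd_cone_diff)
    show "?Y \<in> psd_cone"
      by (intro psd_cone_congruence diag_symmat_psd) simp
    show "0 \<le> inner ?Z W" if "W \<in> psd_cone" for W
      unfolding inner_congruence inner_diag_symmat
      by (intro sum_nonneg mult_nonneg_nonneg psd_cone_diagonal_nonneg psd_cone_congruence that) simp
  qed
  also have "inner ?Z ?Y = 0"
    by (simp add: inner_congruence congruence_congruence PP inner_diag_symmat
        diag_symmat.rep_eq Diag_def max_def sum.neutral)
  finally show "closest_point psd_cone A = ?Y"
    by (simp add: AYZ)
  then show "closest_point psd_cone A - A = ?Z"
    by (simp add: AYZ)
qed

lemma lyapunov_congruence:
  assumes "orthogonal_matrix P"
  shows "lyapunov (P ** K ** transpose P) (congruence P A) = congruence P (lyapunov K A)"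
proof -
  have *: "transpose P ** (P ** M) = M" for M :: "real^'a^'a"
    using assms by (simp add: orthogonal_matrix matrix_mul_assoc)
  show ?thesis
    by (simp add: mat_of_inject[symmetric] lyapunov.rep_eq congruence.rep_eq matrix_add_ldistrib
        matrix_add_rdistrib matrix_transpose_mul * flip: matrix_mul_assoc)
qed

text \<open>The assumption on \<open>V\<close> is the relation of
  \<open>has_derivative_closest_point_psd_cone\<close>, the property of derivatives of the
  projection that carries over to the whole generalized Jacobian.\<close>

locale spectral_jacobian =
  fixes A :: "'n::finite symmat" and P :: "real^'n^'n" and v :: "real^'n"
    and V :: "'n symmat \<Rightarrow> 'n symmat"
  assumes P: "orthogonal_matrix P" and A: "mat_of A = P ** Diag v ** transpose P"
    and V: "\<And>K. V (lyapunov K (closest_point psd_cone A)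
        + lyapunov (transpose K) (closest_point psd_cone A - A))
      = lyapunov K (closest_point psd_cone A)"
begin

abbreviation rotated :: "'n symmat \<Rightarrow> real^'n^'n" where
  "rotated H \<equiv> mat_of (congruence (transpose P) H)"

text \<open>The relation for \<open>V\<close> written entrywise in the eigenbasis. Computing
  \<open>V\<close> on a given matrix becomes a choice of the entries of \<open>K\<close>.\<close>

lemma spectral_identity:
  assumes H: "\<And>i j. rotated H $ i $ j = K $ i $ j * max (v $ j) 0 + max (v $ i) 0 * K $ j $ i
      + (K $ j $ i * max (- v $ j) 0 + max (- v $ i) 0 * K $ i $ j)"
    and G: "\<And>i j. rotated G $ i $ j = K $ i $ j * max (v $ j) 0 + max (v $ i) 0 * K $ j $ i"
  shows "V H = G"
proof -
  let ?p = "diag_symmat (\<chi> i. max (v $ i) 0)" and ?n = "diag_symmat (\<chi> i. max (- v $ i) 0)"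
  let ?K = "P ** K ** transpose P"
  have rot: "X = congruence P Y" if "\<And>i j. rotated X $ i $ j = mat_of Y $ i $ j" for X Y :: "'n symmat"
  proof -
    have "congruence (transpose P) X = Y"
      using that by (simp add: mat_of_inject[symmetric] vec_eq_iff)
    moreover have "congruence P (congruence (transpose P) X) = X"
      using P by (simp add: congruence_congruence orthogonal_matrix_def)
    ultimately show ?thesis by simp
  qed
  have "transpose ?K = P ** transpose K ** transpose P"
    by (simp add: matrix_transpose_mul matrix_mul_assoc)
  with V[of ?K, unfolded closest_point_psd_cone_spectral(2)[OF P A],
      unfolded closest_point_psd_cone_spectral(1)[OF P A]]
  have "V (congruence P (lyapunov K ?p + lyapunov (transpose K) ?n)) = congruence P (lyapunov K ?p)"
    by (simp add: lyapunov_congruence[OF P]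
        linear_add[OF bounded_linear.linear[OF bounded_linear_congruence]])
  moreover have "H = congruence P (lyapunov K ?p + lyapunov (transpose K) ?n)"
    by (rule rot) (simp add: H plus_symmat.rep_eq mat_of_lyapunov_diag_nth,
        simp add: transpose_def)
  moreover have "G = congruence P (lyapunov K ?p)"
    by (rule rot) (simp add: G mat_of_lyapunov_diag_nth)
  ultimately show ?thesis by simp
qed

lemma vanishes_on_lower_blocks:
  assumes pos: "\<And>i j. v $ i > 0 \<Longrightarrow> rotated H $ i $ j = 0"
    and zero: "\<And>i j. v $ i = 0 \<Longrightarrow> v $ j = 0 \<Longrightarrow> rotated H $ i $ j = 0"
  shows "V H = 0"
proof (rule spectral_identity)
  let ?B = "rotated H"
  \<comment> \<open>Rows in \<gamma> and columns in \<beta> or \<gamma>, so the positive part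
    contributes nothing. On the block \<gamma>\<gamma> both terms with the negative part contribute
    equally, hence the factor 2; on \<gamma>\<beta> only one does.\<close>
  let ?K = "\<chi> i j. if v $ i < 0 then
      (if v $ j < 0 then - ?B $ i $ j / (2 * v $ i) else if v $ j = 0 then - ?B $ i $ j / v $ i else 0)
      else 0"
  have pos': "v $ j > 0 \<Longrightarrow> rotated H $ i $ j = 0" for i j
    using pos[of j i] by (metis mat_of_nth_sym)
  show "?B $ i $ j = ?K $ i $ j * max (v $ j) 0 + max (v $ i) 0 * ?K $ j $ i
      + (?K $ j $ i * max (- v $ j) 0 + max (- v $ i) 0 * ?K $ i $ j)" for i j
    using mat_of_nth_sym[of "congruence (transpose P) H" i j] pos[of i j] pos'[of j i] zero[of i j]
    by (cases "v $ i" "0::real" rule: linorder_cases; cases "v $ j" "0::real" rule: linorder_cases)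
      (simp_all add: max_def)
  show "rotated 0 $ i $ j = ?K $ i $ j * max (v $ j) 0 + max (v $ i) 0 * ?K $ j $ i" for i j
    by (simp add: congruence.rep_eq zero_symmat.rep_eq matrix_matrix_mult_def max_def)
qed

lemma fixes_upper_blocks:
  assumes zero: "\<And>i j. v $ i = 0 \<Longrightarrow> v $ j = 0 \<Longrightarrow> rotated H $ i $ j = 0"
    and neg: "\<And>i j. v $ j < 0 \<Longrightarrow> rotated H $ i $ j = 0"
  shows "V H = H"
proof (rule spectral_identity)
  let ?B = "rotated H"
  \<comment> \<open>The mirror choice: columns in \<alpha> and rows in \<alpha> or \<beta>. Now the
    negative part contributes nothing, so both sides of the relation equal \<open>H\<close>.\<close>
  let ?K = "\<chi> i j. if v $ j > 0 then
      (if v $ i > 0 then ?B $ i $ j / (2 * v $ j) else if v $ i = 0 then ?B $ i $ j / v $ j else 0)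
      else 0"
  have neg': "v $ i < 0 \<Longrightarrow> rotated H $ i $ j = 0" for i j
    using neg[of i j] by (metis mat_of_nth_sym)
  show "?B $ i $ j = ?K $ i $ j * max (v $ j) 0 + max (v $ i) 0 * ?K $ j $ i
      + (?K $ j $ i * max (- v $ j) 0 + max (- v $ i) 0 * ?K $ i $ j)"
    and "?B $ i $ j = ?K $ i $ j * max (v $ j) 0 + max (v $ i) 0 * ?K $ j $ i" for i j
    using mat_of_nth_sym[of "congruence (transpose P) H" i j] neg[of j i] neg'[of i j] zero[of i j]
    by (cases "v $ i" "0::real" rule: linorder_cases; cases "v $ j" "0::real" rule: linorder_cases;
        simp add: max_def)+
qed

end

section \<open>Second derivatives of real functions\<close>

text \<open>The mean value theorem is used twice: along \<open>d\<close> for the increment of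
  \<open>\<phi>\<close> over \<open>t *\<^sub>R e\<close>, then along \<open>e\<close> for the
  derivative of \<open>\<phi>\<close> in direction \<open>d\<close>.\<close>

lemma second_difference_eq:
  fixes \<phi> :: "'a::real_normed_vector \<Rightarrow> real"
  assumes d1: "\<And>y. (\<phi> has_derivative \<phi>' y) (at y)"
    and d2: "\<And>y e. ((\<lambda>y. \<phi>' y e) has_derivative (\<lambda>d. \<phi>'' y d e)) (at y)"
    and "t > 0"
  shows "\<exists>p q. 0 \<le> p \<and> p \<le> t \<and> 0 \<le> q \<and> q \<le> t \<and>
    \<phi> (x + t *\<^sub>R d + t *\<^sub>R e) - \<phi> (x + t *\<^sub>R d) - \<phi> (x + t *\<^sub>R e) + \<phi> x
      = t\<^sup>2 * \<phi>'' (x + p *\<^sub>R d + q *\<^sub>R e) e d"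
proof -
  have sc1: "\<phi>' y (c *\<^sub>R d) = c * \<phi>' y d" for y c d
    using linear_scale[OF has_derivative_linear[OF d1[of y]]] by simp
  have sc2: "\<phi>'' y (c *\<^sub>R e) d = c * \<phi>'' y e d" for y c d e
    using linear_scale[OF has_derivative_linear[OF d2[of d y]]] by simp
  define u where "u s = \<phi> (x + s *\<^sub>R d + t *\<^sub>R e) - \<phi> (x + s *\<^sub>R d)" for s
  have "(u has_derivative (\<lambda>r. \<phi>' (x + s *\<^sub>R d + t *\<^sub>R e) (r *\<^sub>R d) - \<phi>' (x + s *\<^sub>R d) (r *\<^sub>R d)))
      (at s within {0..t})" for s
    unfolding u_def
    by (intro has_derivative_diff has_derivative_compose[OF _ d1])
       (auto intro!: derivative_eq_intros)
  from mvt_simple[OF \<open>t > 0\<close> this] obtain p where p: "0 < p" "p < t"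
    and up: "u t - u 0 = \<phi>' (x + p *\<^sub>R d + t *\<^sub>R e) (t *\<^sub>R d) - \<phi>' (x + p *\<^sub>R d) (t *\<^sub>R d)"
    by auto
  define w where "w s = \<phi>' (x + p *\<^sub>R d + s *\<^sub>R e) d" for s
  have "(w has_derivative (\<lambda>r. \<phi>'' (x + p *\<^sub>R d + s *\<^sub>R e) (r *\<^sub>R e) d)) (at s within {0..t})" for s
    unfolding w_def
    by (intro has_derivative_compose[OF _ d2]) (auto intro!: derivative_eq_intros)
  from mvt_simple[OF \<open>t > 0\<close> this] obtain q where q: "0 < q" "q < t"
    and wq: "w t - w 0 = \<phi>'' (x + p *\<^sub>R d + q *\<^sub>R e) (t *\<^sub>R e) d"
    by auto
  have "\<phi> (x + t *\<^sub>R d + t *\<^sub>R e) - \<phi> (x + t *\<^sub>R d) - \<phi> (x + t *\<^sub>R e) + \<phi> x = u t - u 0"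
    by (simp add: u_def)
  also have "\<dots> = t * (w t - w 0)"
    by (simp add: up sc1 w_def right_diff_distrib)
  also have "\<dots> = t\<^sup>2 * \<phi>'' (x + p *\<^sub>R d + q *\<^sub>R e) e d"
    by (simp add: wq sc2 power2_eq_square)
  finally show ?thesis
    using p q by (intro exI[of _ p] exI[of _ q]) simp
qed

text \<open>The second difference is symmetric in \<open>d\<close> and \<open>e\<close>; divided by
  \<open>t\<^sup>2\<close>, it tends to either mixed derivative, depending on which direction is
  treated first.\<close>

lemma second_derivative_symmetric:
  fixes \<phi> :: "'a::real_normed_vector \<Rightarrow> real"
  assumes d1: "\<And>y. (\<phi> has_derivative \<phi>' y) (at y)"
    and d2: "\<And>y e. ((\<lambda>y. \<phi>' y e) has_derivative (\<lambda>d. \<phi>'' y d e)) (at y)"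
    and cont: "\<And>d e. isCont (\<lambda>y. \<phi>'' y d e) x"
  shows "\<phi>'' x d e = \<phi>'' x e d"
proof -
  define \<Delta> where "\<Delta> t = (\<phi> (x + t *\<^sub>R d + t *\<^sub>R e) - \<phi> (x + t *\<^sub>R d) - \<phi> (x + t *\<^sub>R e) + \<phi> x) / t\<^sup>2" for t
  define r :: "nat \<Rightarrow> real" where "r n = 1 / real (Suc n)" for n
  have r: "r n > 0" for n by (simp add: r_def)
  have r0: "r \<longlonglongrightarrow> 0"
    unfolding r_def using LIMSEQ_inverse_real_of_nat by (simp add: divide_inverse)
  have lim: "(\<lambda>n. (\<phi> (x + r n *\<^sub>R a + r n *\<^sub>R b) - \<phi> (x + r n *\<^sub>R a) - \<phi> (x + r n *\<^sub>R b) + \<phi> x)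
      / (r n)\<^sup>2) \<longlonglongrightarrow> \<phi>'' x b a" for a b
  proof -
    have "\<exists>p q. 0 \<le> p \<and> p \<le> r n \<and> 0 \<le> q \<and> q \<le> r n \<and>
      (\<phi> (x + r n *\<^sub>R a + r n *\<^sub>R b) - \<phi> (x + r n *\<^sub>R a) - \<phi> (x + r n *\<^sub>R b) + \<phi> x) / (r n)\<^sup>2
        = \<phi>'' (x + p *\<^sub>R a + q *\<^sub>R b) b a" for n
      using second_difference_eq[where \<phi>''=\<phi>'', OF d1 d2 r[of n], of x a b] r[of n] by fastforce
    then obtain p q where pq: "\<And>n. 0 \<le> p n" "\<And>n. p n \<le> r n" "\<And>n. 0 \<le> q n" "\<And>n. q n \<le> r n"
      and eq: "\<And>n. (\<phi> (x + r n *\<^sub>R a + r n *\<^sub>R b) - \<phi> (x + r n *\<^sub>R a) - \<phi> (x + r n *\<^sub>R b) + \<phi> x)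
        / (r n)\<^sup>2 = \<phi>'' (x + p n *\<^sub>R a + q n *\<^sub>R b) b a"
      by metis
    have "p \<longlonglongrightarrow> 0" "q \<longlonglongrightarrow> 0"
      using pq by (auto intro!: tendsto_sandwich[OF _ _ tendsto_const r0])
    then have "(\<lambda>n. x + p n *\<^sub>R a + q n *\<^sub>R b) \<longlonglongrightarrow> x"
      by (auto intro!: tendsto_eq_intros)
    from isCont_tendsto_compose[OF cont this] show ?thesis
      unfolding eq .
  qed
  have "(\<lambda>n. \<Delta> (r n)) \<longlonglongrightarrow> \<phi>'' x e d"
    unfolding \<Delta>_def by (rule lim)
  moreover have "(\<lambda>n. \<Delta> (r n)) \<longlonglongrightarrow> \<phi>'' x d e"
    using lim[of e d] unfolding \<Delta>_def by (simp add: algebra_simps)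
  ultimately show ?thesis
    by (metis LIMSEQ_unique)
qed

lemma convex_second_derivative_nonneg:
  fixes \<phi> :: "'a::real_normed_vector \<Rightarrow> real"
  assumes convex: "convex_on UNIV \<phi>"
    and d1: "\<And>y. (\<phi> has_derivative \<phi>' y) (at y)"
    and d2: "((\<lambda>y. \<phi>' y d) has_derivative (\<lambda>e. \<phi>'' e)) (at x)"
  shows "0 \<le> \<phi>'' d"
proof -
  define u where "u t = \<phi> (x + t *\<^sub>R d)" for t
  define u' where "u' t = \<phi>' (x + t *\<^sub>R d) d" for t
  have "convex_on UNIV u"
  proof (rule convex_onI)
    fix t a b :: real assume "0 < t" "t < 1"
    have "u ((1 - t) *\<^sub>R a + t *\<^sub>R b) = \<phi> ((1 - t) *\<^sub>R (x + a *\<^sub>R d) + t *\<^sub>R (x + b *\<^sub>R d))"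
      by (simp add: u_def algebra_simps)
    also have "\<dots> \<le> (1 - t) * u a + t * u b"
      unfolding u_def using \<open>0 < t\<close> \<open>t < 1\<close> by (intro convex_onD[OF convex]) auto
    finally show "u ((1 - t) *\<^sub>R a + t *\<^sub>R b) \<le> (1 - t) * u a + t * u b" .
  qed simp
  moreover have du: "(u has_field_derivative u' t) (at t)" for t
  proof -
    have "(u has_derivative (\<lambda>r. \<phi>' (x + t *\<^sub>R d) (r *\<^sub>R d))) (at t)"
      unfolding u_def
      by (intro has_derivative_compose[OF _ d1]) (auto intro!: derivative_eq_intros)
    moreover have "\<phi>' (x + t *\<^sub>R d) (r *\<^sub>R d) = u' t * r" for r
      using linear_scale[OF has_derivative_linear[OF d1]] by (simp add: u'_def mult.commute)
    ultimately show ?thesis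
      by (simp add: has_field_derivative_def)
  qed
  ultimately have tangent: "u' s * (t - s) \<le> u t - u s" for s t
    using convex_on_imp_above_tangent[of UNIV u s t "u' s"] by simp
  \<comment> \<open>Adding the tangent inequalities at \<open>0\<close> and at \<open>t\<close>
    cancels the values of \<open>u\<close>. Only \<open>t > 0\<close> is covered, so the limit below
    is taken from the right.\<close>
  have mono: "u' 0 \<le> u' t" if "t > 0" for t
  proof -
    have "u' 0 * t \<le> u' t * t"
      using tangent[of 0 t] tangent[of t 0] by simp
    then show ?thesis using that by simp
  qed
  have "((\<lambda>t. \<phi>' (x + t *\<^sub>R d) d) has_derivative (\<lambda>r. \<phi>'' (r *\<^sub>R d))) (at 0)"
    using d2 by (intro has_derivative_compose[where f="\<lambda>t. x + t *\<^sub>R d" and g="\<lambda>y. \<phi>' y d"])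
       (auto intro!: derivative_eq_intros)
  moreover have "\<phi>'' (r *\<^sub>R d) = \<phi>'' d * r" for r
    using linear_scale[OF has_derivative_linear[OF d2]] by simp
  ultimately have "(u' has_field_derivative \<phi>'' d) (at 0)"
    unfolding u'_def[abs_def] by (simp add: has_field_derivative_def)
  then have "((\<lambda>t. (u' t - u' 0) / (t - 0)) \<longlongrightarrow> \<phi>'' d) (at_right 0)"
    unfolding has_field_derivative_iff by (rule tendsto_within_subset) simp
  then show ?thesis
    by (rule tendsto_lowerbound)
       (auto simp: mono intro!: eventually_at_rightI[of 0 1])
qed

text \<open>Along \<open>x + s *\<^sub>R y\<close> the quadratic form has no constant term and is
  nonnegative, so its linear coefficient \<open>2 * b x y\<close> vanishes. Applied to the Hessian,
  this turns a zero of the quadratic form into a kernel vector.\<close>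

lemma psd_bilinear_null_vector:
  fixes b :: "'a::real_vector \<Rightarrow> 'a \<Rightarrow> real"
  assumes lin: "\<And>y. linear (\<lambda>x. b x y)" and sym: "\<And>x y. b x y = b y x"
    and nonneg: "\<And>x. 0 \<le> b x x" and "b x x = 0"
  shows "b x y = 0"
proof -
  have "2 * b x y = 0"
  proof (rule nonneg_quadratic_imp_linear_coeff_zero)
    fix s :: real
    have lin': "linear (\<lambda>y. b z y)" for z
      unfolding sym[of z] by (rule lin)
    have "b (x + s *\<^sub>R y) (x + s *\<^sub>R y) = s * (2 * b x y) + s\<^sup>2 * b y y"
      using linear_add[OF lin] linear_scale[OF lin] \<open>b x x = 0\<close> sym[of y x] 
        linear_add[OF lin'] linear_scale[OF lin']
      by (simp add: power2_eq_square algebra_simps)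
    then show "0 \<le> s * (2 * b x y) + s\<^sup>2 * b y y"
      using nonneg[of "x + s *\<^sub>R y"] by simp
  qed
  then show ?thesis by simp
qed

section \<open>The generalized Jacobian of the KKT residual\<close>

text \<open>The Riesz vector of the derivative shows that the definite description in
  \<open>gradient\<close> is met by exactly one vector. From here on gradients are handled through
  their inner products.\<close>

lemma inner_gradient:
  assumes "(\<phi> has_derivative \<phi>') (at x)"
  shows "inner (gradient \<phi> x) d = \<phi>' d"
proof -
  define D where "D = (\<Sum>b\<in>Basis. \<phi>' b *\<^sub>R b)"
  have D: "inner d D = \<phi>' d" for d
  proof -
    have "\<phi>' d = \<phi>' (\<Sum>b\<in>Basis. inner d b *\<^sub>R b)"
      by (simp add: euclidean_representation)
    also have "\<dots> = inner d D"
      using has_derivative_linear[OF assms]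
      by (simp add: linear_sum linear_scale D_def inner_sum_right mult.commute)
    finally show ?thesis by simp
  qed
  have "GDERIV \<phi> x :> D"
    unfolding gderiv_def D using assms .
  moreover have "E = D" if "GDERIV \<phi> x :> E" for E
    using has_derivative_unique[OF that[unfolded gderiv_def] assms] D
    by (metis inner_commute vector_eq_ldot)
  ultimately have "gradient \<phi> x = D"
    unfolding gradient_def by (rule the_equality)
  then show ?thesis using D[of d] by (simp add: inner_commute)
qed

locale nlsdp =
  fixes f :: "'a::euclidean_space \<Rightarrow> real" and f' f''
    and h :: "'a \<Rightarrow> real^'m" and h' h''
    and g :: "'a \<Rightarrow> 'n::finite symmat" and g' g''
  assumes f': "\<And>x. (f has_derivative blinfun_apply (f' x)) (at x)"
    and f'': "\<And>x. (f' has_derivative blinfun_apply (f'' x)) (at x)"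
    and cont_f'': "continuous_on UNIV f''"
    and h': "\<And>x. (h has_derivative blinfun_apply (h' x)) (at x)"
    and h'': "\<And>x. (h' has_derivative blinfun_apply (h'' x)) (at x)"
    and cont_h'': "continuous_on UNIV h''"
    and g': "\<And>x. (g has_derivative blinfun_apply (g' x)) (at x)"
    and g'': "\<And>x. (g' has_derivative blinfun_apply (g'' x)) (at x)"
    and cont_g'': "continuous_on UNIV g''"
begin

definition dL where
  "dL x \<xi> \<Gamma> d = f' x d + inner \<xi> (h' x d) + inner \<Gamma> (g' x d)"

text \<open>The Hessian of the Lagrangian as a bilinear form: \<open>d\<close> is the direction of
  the first differentiation and \<open>e\<close> that of the second.\<close>

definition d2L where
  "d2L x \<xi> \<Gamma> e d = f'' x e d + inner \<xi> (h'' x e d) + inner \<Gamma> (g'' x e d)"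

lemma has_derivative_lagrangian:
  "((\<lambda>y. lagrangian f h g y \<xi> \<Gamma>) has_derivative dL x \<xi> \<Gamma>) (at x)"
  unfolding lagrangian_def dL_def[abs_def]
  by (auto intro!: derivative_eq_intros f' h' g')

lemmas inner_gradient_lagrangian = inner_gradient[OF has_derivative_lagrangian]

lemma has_derivative_dL:
  "((\<lambda>z. dL (fst z) (fst (snd z)) (snd (snd z)) d) has_derivative
    (\<lambda>w. d2L x \<xi> \<Gamma> (fst w) d + inner (fst (snd w)) (h' x d) + inner (snd (snd w)) (g' x d)))
    (at (x, \<xi>, \<Gamma>))"
proof -
  have fst: "(fst has_derivative fst) (at (x, \<xi>, \<Gamma>))"
    by (auto intro!: derivative_eq_intros)
  have *: "((\<lambda>z. F' (fst z) d) has_derivative (\<lambda>w. F'' (fst w) d)) (at (x, \<xi>, \<Gamma>))"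
    if "(F' has_derivative blinfun_apply F'') (at x)"
    for F' :: "'a \<Rightarrow> 'a \<Rightarrow>\<^sub>L 'c::real_normed_vector" and F''
    using that
    by (intro bounded_linear.has_derivative[OF blinfun.bounded_linear_left]
        has_derivative_compose[OF fst]) simp
  have "((\<lambda>z. fst (snd z)) has_derivative (\<lambda>w. fst (snd w))) (at (x, \<xi>, \<Gamma>))"
    "((\<lambda>z. snd (snd z)) has_derivative (\<lambda>w. snd (snd w))) (at (x, \<xi>, \<Gamma>))"
    by (auto intro!: derivative_eq_intros)
  note d = has_derivative_add[OF has_derivative_add[OF *[OF f'']
    has_derivative_inner[OF this(1) *[OF h'']]] has_derivative_inner[OF this(2) *[OF g'']]]
  show ?thesis
    unfolding dL_def
    by (rule has_derivative_eq_rhs[OF d]) (simp add: d2L_def fun_eq_iff)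
qed

lemma has_derivative_dL_left:
  "((\<lambda>y. dL y \<xi> \<Gamma> d) has_derivative (\<lambda>e. d2L x \<xi> \<Gamma> e d)) (at x)"
proof -
  have "((\<lambda>y. (y, \<xi>, \<Gamma>)) has_derivative (\<lambda>e. (e, 0, 0))) (at x)"
    by (auto intro!: derivative_eq_intros simp: zero_prod_def)
  from has_derivative_compose[OF this has_derivative_dL] show ?thesis
    by simp
qed

lemma isCont_derivatives:
  "isCont g x" "isCont h' x" "isCont g' x" "isCont f'' x" "isCont h'' x" "isCont g'' x"
proof -
  show "isCont g x" by (rule has_derivative_continuous[OF g'])
  show "isCont h' x" by (rule has_derivative_continuous[OF h''])
  show "isCont g' x" by (rule has_derivative_continuous[OF g''])
  show "isCont f'' x" "isCont h'' x" "isCont g'' x"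
    using cont_f'' cont_h'' cont_g'' by (auto simp: continuous_on_eq_continuous_at)
qed

lemma tendsto_d2L:
  assumes "(X \<longlongrightarrow> x) F" "(\<Xi> \<longlongrightarrow> \<xi>) F" "(G \<longlongrightarrow> \<Gamma>) F"
  shows "((\<lambda>k. d2L (X k) (\<Xi> k) (G k) e d) \<longlongrightarrow> d2L x \<xi> \<Gamma> e d) F"
  unfolding d2L_def
  by (intro tendsto_intros blinfun.tendsto isCont_tendsto_compose[OF isCont_derivatives(4)]
      isCont_tendsto_compose[OF isCont_derivatives(5)]
      isCont_tendsto_compose[OF isCont_derivatives(6)] assms)

lemma d2L_symmetric: "d2L x \<xi> \<Gamma> d e = d2L x \<xi> \<Gamma> e d"
  by (rule second_derivative_symmetric[OF has_derivative_lagrangian has_derivative_dL_left])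
     (simp add: isCont_def tendsto_d2L)

lemma inner_hessian_lagrangian:
  "inner (hessian (\<lambda>y. lagrangian f h g y \<xi> \<Gamma>) x e) d = d2L x \<xi> \<Gamma> e d"
proof -
  let ?G = "gradient (\<lambda>y. lagrangian f h g y \<xi> \<Gamma>)"
  define H where "H e = (\<Sum>b\<in>Basis. d2L x \<xi> \<Gamma> e b *\<^sub>R b)" for e
  have G: "((\<lambda>y. inner (?G y) d) has_derivative (\<lambda>e. d2L x \<xi> \<Gamma> e d)) (at x)" for d
    unfolding inner_gradient_lagrangian by (rule has_derivative_dL_left)
  have "(?G has_derivative H) (at x)"
    using G by (subst has_derivative_componentwise_within) (simp add: H_def)
  then have "(?G has_derivative hessian (\<lambda>y. lagrangian f h g y \<xi> \<Gamma>) x) (at x)"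
    unfolding hessian_def using frechet_derivative_at by force
  from has_derivative_unique[OF has_derivative_inner_left[OF this] G] show ?thesis
    by meson
qed

text \<open>With \<open>x\<close> and \<open>\<xi>\<close> frozen, the third component of the
  residual is a shifted projection. Differentiability of the residual thus forces that of the
  projection at \<open>g x + \<Gamma>\<close>, with \<open>V\<close> read off from \<open>D\<close>;
  the chain rule then gives the last equation.\<close>

lemma has_derivative_KKT_residual:
  assumes D: "(KKT_residual f h g has_derivative D) (at (x, \<xi>, \<Gamma>))"
  defines "V \<equiv> \<lambda>W. snd (snd (D (0, 0, W)))"
  shows "inner (fst (D w)) d
      = d2L x \<xi> \<Gamma> (fst w) d + inner (fst (snd w)) (h' x d) + inner (snd (snd w)) (g' x d)"
    and "fst (snd (D w)) = h' x (fst w)"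
    and "(closest_point psd_cone has_derivative V) (at (g x + \<Gamma>))"
    and "snd (snd (D w)) = - g' x (fst w) + V (g' x (fst w) + snd (snd w))"
proof -
  let ?z = "(x, \<xi>, \<Gamma>)"
  have fst: "(fst has_derivative fst) (at ?z)"
    by (auto intro!: derivative_eq_intros)
  have eq: "KKT_residual f h g = (\<lambda>z. (gradient (\<lambda>y. lagrangian f h g y (fst (snd z)) (snd (snd z))) (fst z),
      h (fst z), - g (fst z) + closest_point psd_cone (g (fst z) + snd (snd z))))"
    by (auto simp: KKT_residual_def)
  have "((\<lambda>z. inner (fst (KKT_residual f h g z)) d) has_derivative (\<lambda>w. inner (fst (D w)) d)) (at ?z)"
    by (intro has_derivative_inner_left has_derivative_fst D)
  then have "((\<lambda>z. dL (fst z) (fst (snd z)) (snd (snd z)) d) has_derivative (\<lambda>w. inner (fst (D w)) d))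
      (at ?z)"
    by (simp add: eq inner_gradient_lagrangian)
  from has_derivative_unique[OF this has_derivative_dL]
  show "inner (fst (D w)) d
      = d2L x \<xi> \<Gamma> (fst w) d + inner (fst (snd w)) (h' x d) + inner (snd (snd w)) (g' x d)"
    by meson
  have "((\<lambda>z. h (fst z)) has_derivative (\<lambda>w. fst (snd (D w)))) (at ?z)"
    using has_derivative_fst[OF has_derivative_snd[OF D]] by (simp add: eq)
  moreover have "((\<lambda>z. h (fst z)) has_derivative (\<lambda>w. h' x (fst w))) (at ?z)"
    by (rule has_derivative_compose[OF fst]) (simp add: h')
  ultimately show "fst (snd (D w)) = h' x (fst w)"
    by (metis has_derivative_unique)
  have 3: "((\<lambda>z. - g (fst z) + closest_point psd_cone (g (fst z) + snd (snd z)))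
      has_derivative (\<lambda>w. snd (snd (D w)))) (at ?z)"
    using has_derivative_snd[OF has_derivative_snd[OF D]] by (simp add: eq)
  have shift: "((\<lambda>W. (x, \<xi>, W - g x)) has_derivative (\<lambda>W. (0, 0, W))) (at (g x + \<Gamma>))"
    by (auto intro!: derivative_eq_intros)
  have "((\<lambda>z. - g (fst z) + closest_point psd_cone (g (fst z) + snd (snd z)))
      has_derivative (\<lambda>w. snd (snd (D w)))) (at (x, \<xi>, g x + \<Gamma> - g x))"
    using 3 by simp
  from has_derivative_add[OF has_derivative_const[of "g x"] has_derivative_compose[OF shift this]]
  have "((\<lambda>W. g x + (- g x + closest_point psd_cone (g x + (W - g x)))) has_derivative V)
      (at (g x + \<Gamma>))"
    by (simp add: V_def)
  then show V: "(closest_point psd_cone has_derivative V) (at (g x + \<Gamma>))"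
    by simp
  have dg: "((\<lambda>z. g (fst z)) has_derivative (\<lambda>w. g' x (fst w))) (at ?z)"
    by (rule has_derivative_compose[OF fst]) (simp add: g')
  have "((\<lambda>z. g (fst z) + snd (snd z)) has_derivative (\<lambda>w. g' x (fst w) + snd (snd w))) (at ?z)"
    by (intro has_derivative_add dg) (auto intro!: derivative_eq_intros)
  from has_derivative_compose[OF this, of "closest_point psd_cone" V]
  have "((\<lambda>z. closest_point psd_cone (g (fst z) + snd (snd z))) has_derivative
      (\<lambda>w. V (g' x (fst w) + snd (snd w)))) (at ?z)"
    using V by simp
  from has_derivative_unique[OF 3 has_derivative_add[OF has_derivative_minus[OF dg] this]]
  show "snd (snd (D w)) = - g' x (fst w) + V (g' x (fst w) + snd (snd w))"
    by meson
qed

text \<open>Every condition has the form \<open>T U = c\<close> with \<open>T\<close> linear in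
  \<open>U\<close>, so the set is convex. To this end the derivative of the projection is expressed
  as the last component of \<open>U (0, 0, W)\<close>, and the third condition collects both
  occurrences of \<open>U\<close> on one side.\<close>

definition jacobian_relations ::
    "'a \<Rightarrow> real^'m \<Rightarrow> 'n symmat \<Rightarrow>
      (('a \<times> (real^'m) \<times> 'n symmat) \<Rightarrow>\<^sub>L ('a \<times> (real^'m) \<times> 'n symmat)) set" where
  "jacobian_relations x \<xi> \<Gamma> = {U.
    (\<forall>w d. inner (fst (blinfun_apply U w)) d
      = d2L x \<xi> \<Gamma> (fst w) d + inner (fst (snd w)) (h' x d) + inner (snd (snd w)) (g' x d)) \<and>
    (\<forall>w. fst (snd (blinfun_apply U w)) = h' x (fst w)) \<and>
    (\<forall>w. snd (snd (blinfun_apply U w)) - snd (snd (blinfun_apply U (0, 0, g' x (fst w) + snd (snd w)))) = - g' x (fst w)) \<and>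
    (\<forall>K. snd (snd (blinfun_apply U (0, 0, lyapunov K (closest_point psd_cone (g x + \<Gamma>))
          + lyapunov (transpose K) (closest_point psd_cone (g x + \<Gamma>) - (g x + \<Gamma>)))))
      = lyapunov K (closest_point psd_cone (g x + \<Gamma>)))}"

lemma convex_jacobian_relations: "convex (jacobian_relations x \<xi> \<Gamma>)"
proof -
  have *: "convex {U :: ('a \<times> (real^'m) \<times> 'n symmat) \<Rightarrow>\<^sub>L ('a \<times> (real^'m) \<times> 'n symmat). T U = c}"
    if "linear T" for T :: "_ \<Rightarrow> 'b::real_vector" and c
  proof (rule convexI)
    fix U W :: "('a \<times> (real^'m) \<times> 'n symmat) \<Rightarrow>\<^sub>L ('a \<times> (real^'m) \<times> 'n symmat)" and u w :: real
    assume "U \<in> {U. T U = c}" "W \<in> {U. T U = c}" "u + w = 1"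
    then show "u *\<^sub>R U + w *\<^sub>R W \<in> {U. T U = c}"
      by (simp add: linear_add[OF that] linear_scale[OF that] flip: scaleR_left_distrib)
  qed
  show ?thesis
    unfolding jacobian_relations_def Collect_conj_eq Collect_all_eq
    by (intro convex_Int convex_INT *)
       (auto intro!: linearI simp: blinfun.add_left blinfun.scaleR_left inner_add_left algebra_simps)
qed

lemma B_subdifferential_subset: 
  "B_subdifferential (KKT_residual f h g) (x, \<xi>, \<Gamma>) \<subseteq> jacobian_relations x \<xi> \<Gamma>"
proof
  fix U assume "U \<in> B_subdifferential (KKT_residual f h g) (x, \<xi>, \<Gamma>)"
  then obtain Z D where Z: "Z \<longlonglongrightarrow> (x, \<xi>, \<Gamma>)" and D: "D \<longlonglongrightarrow> U"
    and F': "\<And>k. (KKT_residual f h g has_derivative blinfun_apply (D k)) (at (Z k))"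
    by (auto simp: B_subdifferential_def)
  define X \<Xi> G where "X k = fst (Z k)" and "\<Xi> k = fst (snd (Z k))" and "G k = snd (snd (Z k))" for k
  have lim: "X \<longlonglongrightarrow> x" "\<Xi> \<longlonglongrightarrow> \<xi>" "G \<longlonglongrightarrow> \<Gamma>"
    using tendsto_fst[OF Z] tendsto_fst[OF tendsto_snd[OF Z]] tendsto_snd[OF tendsto_snd[OF Z]]
    by (simp_all add: X_def[abs_def] \<Xi>_def[abs_def] G_def[abs_def])
  have "(KKT_residual f h g has_derivative blinfun_apply (D k)) (at (X k, \<Xi> k, G k))" for k
    using F'[of k] by (simp add: X_def \<Xi>_def G_def)
  note rel = has_derivative_KKT_residual[OF this]
  \<comment> \<open>The arguments vary with \<open>k\<close> as well, since \<open>g'\<close> and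
    the projection are evaluated at the iterates; operator norm convergence gives the joint
    limit.\<close>
  have U: "(\<lambda>k. D k (W k)) \<longlonglongrightarrow> U w" if "W \<longlonglongrightarrow> w" for W w
    by (rule blinfun.tendsto[OF D that])
  have lh: "(\<lambda>k. h' (X k) d) \<longlonglongrightarrow> h' x d" and lg: "(\<lambda>k. g' (X k) d) \<longlonglongrightarrow> g' x d" for d
    by (intro blinfun.tendsto isCont_tendsto_compose[OF isCont_derivatives(2)]
        isCont_tendsto_compose[OF isCont_derivatives(3)] lim tendsto_const)+
  have 1: "inner (fst (U w)) d
      = d2L x \<xi> \<Gamma> (fst w) d + inner (fst (snd w)) (h' x d) + inner (snd (snd w)) (g' x d)" for w d
  proof (rule LIMSEQ_unique)
    show "(\<lambda>k. inner (fst (D k w)) d) \<longlonglongrightarrow> inner (fst (U w)) d"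
      by (intro tendsto_intros U)
    show "(\<lambda>k. inner (fst (D k w)) d) \<longlonglongrightarrow>
        d2L x \<xi> \<Gamma> (fst w) d + inner (fst (snd w)) (h' x d) + inner (snd (snd w)) (g' x d)"
      unfolding rel(1) by (intro tendsto_intros tendsto_d2L lim lh lg)
  qed
  have 2: "fst (snd (U w)) = h' x (fst w)" for w
  proof (rule LIMSEQ_unique)
    show "(\<lambda>k. fst (snd (D k w))) \<longlonglongrightarrow> fst (snd (U w))"
      by (intro tendsto_intros U)
    show "(\<lambda>k. fst (snd (D k w))) \<longlonglongrightarrow> h' x (fst w)"
      unfolding rel(2) by (rule lh)
  qed
  have 3: "snd (snd (U w)) - snd (snd (U (0, 0, g' x (fst w) + snd (snd w)))) = - g' x (fst w)" for w
  proof (rule LIMSEQ_unique)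
    show "(\<lambda>k. snd (snd (D k w)) - snd (snd (D k (0, 0, g' (X k) (fst w) + snd (snd w)))))
        \<longlonglongrightarrow> snd (snd (U w)) - snd (snd (U (0, 0, g' x (fst w) + snd (snd w))))"
      by (intro tendsto_intros U lg)
    show "(\<lambda>k. snd (snd (D k w)) - snd (snd (D k (0, 0, g' (X k) (fst w) + snd (snd w)))))
        \<longlonglongrightarrow> - g' x (fst w)"
      unfolding rel(4)[of _ w] by (simp add: lg tendsto_minus)
  qed
  define A where "A k = g (X k) + G k" for k
  have A: "A \<longlonglongrightarrow> g x + \<Gamma>"
    unfolding A_def[abs_def]
    by (intro tendsto_add isCont_tendsto_compose[OF isCont_derivatives(1)] lim)
  have Y: "(\<lambda>k. closest_point psd_cone (A k)) \<longlonglongrightarrow> closest_point psd_cone (g x + \<Gamma>)"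
    using zero_in_psd_cone
    by (intro isCont_tendsto_compose[OF continuous_at_closest_point[OF convex_psd_cone closed_psd_cone]] A)
       auto
  note lyap = bounded_linear.tendsto[OF bounded_linear_lyapunov]
  have 4: "snd (snd (U (0, 0, lyapunov K (closest_point psd_cone (g x + \<Gamma>))
          + lyapunov (transpose K) (closest_point psd_cone (g x + \<Gamma>) - (g x + \<Gamma>)))))
      = lyapunov K (closest_point psd_cone (g x + \<Gamma>))" for K
  proof (rule LIMSEQ_unique)
    show "(\<lambda>k. lyapunov K (closest_point psd_cone (A k)))
        \<longlonglongrightarrow> lyapunov K (closest_point psd_cone (g x + \<Gamma>))"
      by (intro lyap Y)
    have "(\<lambda>k. snd (snd (D k (0, 0, lyapunov K (closest_point psd_cone (A k))
          + lyapunov (transpose K) (closest_point psd_cone (A k) - A k)))))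
        \<longlonglongrightarrow> snd (snd (U (0, 0, lyapunov K (closest_point psd_cone (g x + \<Gamma>))
          + lyapunov (transpose K) (closest_point psd_cone (g x + \<Gamma>) - (g x + \<Gamma>)))))"
      by (intro tendsto_intros U lyap Y A)
    then show "(\<lambda>k. lyapunov K (closest_point psd_cone (A k)))
        \<longlonglongrightarrow> snd (snd (U (0, 0, lyapunov K (closest_point psd_cone (g x + \<Gamma>))
          + lyapunov (transpose K) (closest_point psd_cone (g x + \<Gamma>) - (g x + \<Gamma>)))))"
      unfolding A_def has_derivative_closest_point_psd_cone[OF rel(3)] .
  qed
  show "U \<in> jacobian_relations x \<xi> \<Gamma>"
    unfolding jacobian_relations_def using 1 2 3 4 by blast
qed

lemma clarke_jacobian_subset:
  "clarke_jacobian (KKT_residual f h g) (x, \<xi>, \<Gamma>) \<subseteq> jacobian_relations x \<xi> \<Gamma>"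
  unfolding clarke_jacobian_def
  by (rule hull_minimal[where S=convex]) (rule B_subdifferential_subset convex_jacobian_relations)+

end

section \<open>Nonsingularity\<close>

lemma normal_cone_psd_cone_nonpos:
  assumes "\<Gamma> \<in> normal_cone psd_cone A" and "W \<in> psd_cone"
  shows "inner \<Gamma> W \<le> 0"
proof -
  have "A \<in> psd_cone" using assms(1) by (simp add: normal_cone_def)
  then have "A + W \<in> psd_cone"
    using assms(2) by (simp add: psd_cone_def plus_symmat.rep_eq matrix_vector_mult_add_rdistrib
        inner_add_right)
  then have "inner \<Gamma> (A + W - A) \<le> 0"
    using assms(1) unfolding normal_cone_def by blast
  then show ?thesis by simp
qed

lemma convex_on_lagrangian:
  assumes "convex_NLSDP f h g" and \<Gamma>: "\<And>W. W \<in> psd_cone \<Longrightarrow> inner \<Gamma> W \<le> 0"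
  shows "convex_on UNIV (\<lambda>y. lagrangian f h g y \<xi> \<Gamma>)"
proof -
  from assms(1) obtain A b where f: "convex_on UNIV f" and A: "linear A"
    and h: "h = (\<lambda>x. A x + b)" and g: "psd_convex g"
    by (auto simp: convex_NLSDP_def)
  show ?thesis
  proof (rule convex_onI)
    fix t :: real and y z assume t: "0 < t" "t < 1"
    have "f ((1 - t) *\<^sub>R y + t *\<^sub>R z) \<le> (1 - t) * f y + t * f z"
      using t by (intro convex_onD[OF f]) auto
    moreover have "inner \<xi> (h ((1 - t) *\<^sub>R y + t *\<^sub>R z))
        = (1 - t) * inner \<xi> (h y) + t * inner \<xi> (h z)"
      by (simp add: h linear_add[OF A] linear_scale[OF A] inner_add_right) (simp add: ring_distribs)
    moreover have "inner \<Gamma> (g ((1 - t) *\<^sub>R y + t *\<^sub>R z))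
        \<le> (1 - t) * inner \<Gamma> (g y) + t * inner \<Gamma> (g z)"
    proof -
      \<comment> \<open>The convexity defect of \<open>g\<close> lies in the cone, where
        \<open>\<Gamma>\<close> is nonpositive; this sign makes \<open>inner \<Gamma> (g y)\<close>
        convex in \<open>y\<close>.\<close>
      have "g ((1 - t) *\<^sub>R y + (1 - (1 - t)) *\<^sub>R z) - (1 - t) *\<^sub>R g y - (1 - (1 - t)) *\<^sub>R g z \<in> psd_cone"
        using g[unfolded psd_convex_def, rule_format, of "1 - t" y z] t by simp
      from \<Gamma>[OF this] show ?thesis
        by (simp add: inner_diff_right)
    qed
    ultimately show "lagrangian f h g ((1 - t) *\<^sub>R y + t *\<^sub>R z) \<xi> \<Gamma>
        \<le> (1 - t) * lagrangian f h g y \<xi> \<Gamma> + t * lagrangian f h g z \<xi> \<Gamma>"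
      unfolding lagrangian_def by (simp only: ring_distribs)
  qed simp
qed

text \<open>The test matrix is \<open>Q\<close> with its entries in \<open>M\<close> set to zero; it
  is symmetric because \<open>M\<close> is. Its squared norm equals its inner product with
  \<open>Q\<close>, which is zero.\<close>

lemma orthogonal_to_masked_symmat:
  fixes Q :: "'n::finite symmat"
  assumes "\<And>i j. M i j \<longleftrightarrow> M j i"
    and "\<And>B. (\<And>i j. M i j \<Longrightarrow> mat_of B $ i $ j = 0) \<Longrightarrow> inner Q B = 0"
    and "\<not> M i j"
  shows "mat_of Q $ i $ j = 0"
proof -
  define B where "B = Symmat (\<chi> i j. if M i j then 0 else mat_of Q $ i $ j)"
  have B: "mat_of B = (\<chi> i j. if M i j then 0 else mat_of Q $ i $ j)"
    unfolding B_def using assms(1)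
    by (subst Symmat_inverse) (auto simp: transpose_def vec_eq_iff mat_of_nth_sym)
  have "inner B B = inner Q B"
    by (auto simp: inner_mat_of inner_vec_def B intro!: sum.cong)
  also have "\<dots> = 0"
    by (rule assms(2)) (simp add: B)
  finally have "mat_of B $ i $ j = 0"
    by (simp add: zero_symmat.rep_eq)
  then show ?thesis
    using assms(3) by (simp add: B)
qed

section \<open>Kernel vectors of an element of the generalized Jacobian\<close>

context nlsdp
begin

lemma frechet_derivatives:
  "frechet_derivative h (at x) = h' x" "frechet_derivative g (at x) = g' x"
  using frechet_derivative_at[OF h'] frechet_derivative_at[OF g'] by simp_all

context
  fixes x \<xi> \<Gamma> P v U
  assumes spec: "orthogonal_matrix P" "mat_of (g x + \<Gamma>) = P ** Diag v ** transpose P"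
    and U: "U \<in> jacobian_relations x \<xi> \<Gamma>" and bij: "bij (blinfun_apply U)"
begin

lemma jacobian_fst: "inner (fst (U w)) d
    = d2L x \<xi> \<Gamma> (fst w) d + inner (fst (snd w)) (h' x d) + inner (snd (snd w)) (g' x d)"
  and jacobian_snd: "fst (snd (U w)) = h' x (fst w)"
  and jacobian_third:
    "snd (snd (U w)) = - g' x (fst w) + snd (snd (U (0, 0, g' x (fst w) + snd (snd w))))"
proof -
  have "snd (snd (U w)) - snd (snd (U (0, 0, g' x (fst w) + snd (snd w)))) = - g' x (fst w)"
    using U unfolding jacobian_relations_def by blast
  then show "snd (snd (U w)) = - g' x (fst w) + snd (snd (U (0, 0, g' x (fst w) + snd (snd w))))"
    unfolding diff_eq_eq .
qed (use U in \<open>unfold jacobian_relations_def, blast+\<close>)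

lemma jacobian_kernel: "U w = 0 \<Longrightarrow> w = 0"
  using bij blinfun.zero_right[of U] by (metis bij_def injD)

interpretation spectral_jacobian "g x + \<Gamma>" P v "\<lambda>W. snd (snd (U (0, 0, W)))"
  using spec U unfolding jacobian_relations_def by unfold_locales auto

lemma nonsingular_imp_W_SRCQ: "W_SRCQ h g x P v"
proof (rule ccontr)
  assume not: "\<not> W_SRCQ h g x P v"
  let ?B = "{B :: 'n symmat. (\<forall>i\<in>zero_idx v. \<forall>j\<in>neg_idx v. mat_of B $ i $ j = 0) \<and>
          (\<forall>i\<in>neg_idx v. \<forall>j\<in>neg_idx v. mat_of B $ i $ j = 0)}"
  let ?R = "range (\<lambda>d. (h' x d, g' x d))" and ?N = "(\<lambda>B. (0 :: real^'m, congruence P B)) ` ?B"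
  have "{0} \<times> {C. \<exists>B :: 'n symmat.
          (\<forall>i\<in>zero_idx v. \<forall>j\<in>neg_idx v. mat_of B $ i $ j = 0) \<and>
          (\<forall>i\<in>neg_idx v. \<forall>j\<in>neg_idx v. mat_of B $ i $ j = 0) \<and>
          mat_of C = P ** mat_of B ** transpose P} = ?N"
    by (auto simp: image_iff mat_of_inject simp flip: congruence.rep_eq)
  with not have ne: "?R + ?N \<noteq> UNIV"
    unfolding W_SRCQ_def by (simp add: frechet_derivatives)
  \<comment> \<open>Both summands are linear images of subspaces, so a sum different from the whole
    space has a nonzero vector \<open>a\<close> orthogonal to it.\<close>
  have sub: "subspace (?R + ?N)"
  proof -
    have "subspace ?R"
      by (intro linear_subspace_image subspace_UNIV linearI)
         (simp_all add: blinfun.add_right blinfun.scaleR_right)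
    moreover have "subspace ?N"
    proof (rule linear_subspace_image)
      show "linear (\<lambda>B. (0 :: real^'m, congruence P B))"
        using bounded_linear.linear[OF bounded_linear_congruence[of P]]
        by (intro linearI) (simp_all add: linear_add linear_scale)
      show "subspace ?B"
        by (auto simp: subspace_def zero_symmat.rep_eq plus_symmat.rep_eq scaleR_symmat.rep_eq)
    qed
    ultimately have "subspace {x + y |x y. x \<in> ?R \<and> y \<in> ?N}"
      by (rule subspace_sums)
    moreover have "{x + y |x y. x \<in> ?R \<and> y \<in> ?N} = ?R + ?N"
      unfolding set_plus_def by blast
    ultimately show ?thesis by simp
  qed
  note span = span_eq_iff[THEN iffD2, OF sub]
  from span_not_UNIV_orthogonal[of "?R + ?N", unfolded span, OF ne]
  obtain a where "a \<noteq> 0" and a: "\<And>z. z \<in> ?R + ?N \<Longrightarrow> inner a z = 0"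
    by blast
  define \<eta> \<Theta> where "\<eta> = fst a" and "\<Theta> = snd a"
  have 0: "0 \<in> ?B"
    by (simp add: zero_symmat.rep_eq)
  have z: "congruence P 0 = 0"
    using linear_0[OF bounded_linear.linear[OF bounded_linear_congruence]] .
  have range: "inner \<eta> (h' x d) + inner \<Theta> (g' x d) = 0" for d
  proof -
    have "(h' x d, g' x d) + (0, congruence P 0) \<in> ?R + ?N"
      using 0 by (intro set_plus_intro) auto
    from a[OF this] show ?thesis
      by (simp add: \<eta>_def \<Theta>_def z inner_prod_def)
  qed
  have block: "inner (congruence (transpose P) \<Theta>) B = 0" if "B \<in> ?B" for B
  proof -
    have "(h' x 0, g' x 0) + (0, congruence P B) \<in> ?R + ?N"
      using that by (intro set_plus_intro rangeI imageI)
    from a[OF this] show ?thesis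
      by (simp add: \<Theta>_def inner_prod_def inner_congruence blinfun.zero_right)
  qed
  \<comment> \<open>The blocks \<beta>\<gamma>, \<gamma>\<beta> and \<gamma>\<gamma>. A symmetric
    matrix vanishing there lies in \<open>?B\<close>, so \<open>block\<close> confines the rotated
    \<open>\<Theta>\<close> to these blocks.\<close>
  let ?M = "\<lambda>i j. v $ i \<le> 0 \<and> v $ j \<le> 0 \<and> (v $ i < 0 \<or> v $ j < 0)"
  have off: "rotated \<Theta> $ i $ j = 0" if "\<not> ?M i j" for i j
  proof (rule orthogonal_to_masked_symmat[where M="?M"])
    show "inner (congruence (transpose P) \<Theta>) B = 0" if "\<And>i j. ?M i j \<Longrightarrow> mat_of B $ i $ j = 0" for B
      by (rule block) (simp add: zero_idx_def neg_idx_def that)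
  qed (use that in auto)
  have "snd (snd (U (0, 0, \<Theta>))) = 0"
    by (rule vanishes_on_lower_blocks) (auto intro: off)
  then have "snd (snd (U (0, \<eta>, \<Theta>))) = 0"
    using jacobian_third[of "(0, \<eta>, \<Theta>)"] by (simp add: blinfun.zero_right)
  moreover have "inner (fst (U (0, \<eta>, \<Theta>))) d = 0" for d
    using range[of d]
    by (simp add: jacobian_fst d2L_def blinfun.zero_right blinfun.zero_left)
  then have "fst (U (0, \<eta>, \<Theta>)) = 0"
    using inner_eq_zero_iff by blast
  ultimately have "U (0, \<eta>, \<Theta>) = 0"
    by (simp add: prod_eq_iff jacobian_snd blinfun.zero_right)
  then have "(0, \<eta>, \<Theta>) = (0 :: 'a \<times> (real^'m) \<times> 'n symmat)"
    by (rule jacobian_kernel)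
  then show False
    using \<open>a \<noteq> 0\<close> by (simp add: \<eta>_def \<Theta>_def prod_eq_iff)
qed

lemma nonsingular_imp_W_SOC:
  assumes "convex_NLSDP f h g" and \<Gamma>: "\<And>W. W \<in> psd_cone \<Longrightarrow> inner \<Gamma> W \<le> 0"
  shows "W_SOC f h g x \<xi> \<Gamma> P v"
  unfolding W_SOC_def
proof (intro allI impI, rule ccontr)
  fix d :: 'a
  let ?r = "\<lambda>i j. rotated_derivative g x P d $ i $ j"
  let ?S = "\<Sum>i\<in>pos_idx v. \<Sum>j\<in>neg_idx v. v $ j / v $ i * (?r i j)\<^sup>2"
  assume "d \<noteq> 0" and h0: "frechet_derivative h (at x) d = 0"
    and zz: "\<forall>i\<in>zero_idx v. \<forall>j\<in>zero_idx v. ?r i j = 0"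
    and zn: "\<forall>i\<in>zero_idx v. \<forall>j\<in>neg_idx v. ?r i j = 0"
    and nn: "\<forall>i\<in>neg_idx v. \<forall>j\<in>neg_idx v. ?r i j = 0"
    and "\<not> 0 < inner d (hessian (\<lambda>y. lagrangian f h g y \<xi> \<Gamma>) x d) - 2 * ?S"
  then have le: "d2L x \<xi> \<Gamma> d d \<le> 2 * ?S"
    using inner_hessian_lagrangian[of \<xi> \<Gamma> x d d] by (simp add: inner_commute)
  have psd: "0 \<le> d2L x \<xi> \<Gamma> e e" for e
    by (rule convex_second_derivative_nonneg[OF convex_on_lagrangian[OF assms]
          has_derivative_lagrangian has_derivative_dL_left])
  \<comment> \<open>The eigenvalue ratios are negative, so \<open>?S\<close> is nonpositive while
    the Hessian form is nonnegative; with \<open>le\<close> both must be zero.\<close>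
  have summand_le: "v $ j / v $ i * (?r i j)\<^sup>2 \<le> 0" if "i \<in> pos_idx v" "j \<in> neg_idx v" for i j
    using that by (intro mult_nonpos_nonneg divide_nonpos_pos) (auto simp: pos_idx_def neg_idx_def)
  then have inner_le: "(\<Sum>j\<in>neg_idx v. v $ j / v $ i * (?r i j)\<^sup>2) \<le> 0" if "i \<in> pos_idx v" for i
    using that by (intro sum_nonpos)
  then have "?S \<le> 0"
    by (rule sum_nonpos)
  with le psd[of d] have "d2L x \<xi> \<Gamma> d d = 0" and "?S = 0"
    by linarith+
  have hess0: "d2L x \<xi> \<Gamma> d e = 0" for e
  proof (rule psd_bilinear_null_vector[where b="d2L x \<xi> \<Gamma>"])
    show "linear (\<lambda>d. d2L x \<xi> \<Gamma> d e)" for e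
      by (rule has_derivative_linear[OF has_derivative_dL_left])
  qed (use psd d2L_symmetric \<open>d2L x \<xi> \<Gamma> d d = 0\<close> in auto)
  \<comment> \<open>A vanishing sum of terms of one sign has only zero terms. This adds the block
    \<alpha>\<gamma> to those already known to vanish, as \<open>fixes_upper_blocks\<close>
    requires.\<close>
  have pn: "?r i j = 0" if "i \<in> pos_idx v" "j \<in> neg_idx v" for i j
  proof -
    have "(\<Sum>j\<in>neg_idx v. v $ j / v $ i * (?r i j)\<^sup>2) = 0"
      using \<open>?S = 0\<close> inner_le that(1)
        sum_nonneg_eq_0_iff[of "pos_idx v" "\<lambda>i. - (\<Sum>j\<in>neg_idx v. v $ j / v $ i * (?r i j)\<^sup>2)"]
      by (simp add: sum_negf)
    then have "v $ j / v $ i * (?r i j)\<^sup>2 = 0"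
      using summand_le that sum_nonneg_eq_0_iff[of "neg_idx v" "\<lambda>j. - (v $ j / v $ i * (?r i j)\<^sup>2)"]
      by (simp add: sum_negf)
    then show ?thesis
      using that by (auto simp: pos_idx_def neg_idx_def)
  qed
  have rot: "rotated (g' x d) $ i $ j = ?r i j" for i j
    by (simp add: rotated_derivative_def frechet_derivatives congruence.rep_eq)
  have "snd (snd (U (0, 0, g' x d))) = g' x d"
  proof (rule fixes_upper_blocks)
    show "rotated (g' x d) $ i $ j = 0" if "v $ i = 0" "v $ j = 0" for i j
      unfolding rot using zz that by (simp add: zero_idx_def)
    show "rotated (g' x d) $ i $ j = 0" if "v $ j < 0" for i j
      unfolding rot using zn nn pn[of i j] that
      by (cases "v $ i" "0::real" rule: linorder_cases)
        (simp_all add: zero_idx_def neg_idx_def pos_idx_def)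
  qed
  then have "snd (snd (U (d, 0, 0))) = 0"
    using jacobian_third[of "(d, 0, 0)"] by simp
  moreover have "inner (fst (U (d, 0, 0))) e = 0" for e
    by (simp add: jacobian_fst hess0)
  then have "fst (U (d, 0, 0)) = 0"
    using inner_eq_zero_iff by blast
  ultimately have "U (d, 0, 0) = 0"
    using h0 by (simp add: prod_eq_iff jacobian_snd frechet_derivatives)
  then have "(d, 0, 0) = (0 :: 'a \<times> (real^'m) \<times> 'n symmat)"
    by (rule jacobian_kernel)
  then show False
    using \<open>d \<noteq> 0\<close> by (simp add: prod_eq_iff)
qed

end

end

theorem proposition6:
  fixes f :: "'a::euclidean_space \<Rightarrow> real"
    and h :: "'a \<Rightarrow> real^'m"
    and g :: "'a \<Rightarrow> 'n::{finite,linorder} symmat"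
    and x :: 'a and \<xi> :: "real^'m" and \<Gamma> :: "('n::{finite,linorder}) symmat"
    and P :: "real^('n::{finite,linorder})^('n::{finite,linorder})"
    and v :: "real^('n::{finite,linorder})"
  assumes "twice_continuously_differentiable f"
    and "twice_continuously_differentiable h"
    and "twice_continuously_differentiable g"
    and "stationary_point f h g x"
    and "(\<xi>, \<Gamma>) \<in> multipliers f h g x"
    and "ordered_eigendecomposition (g x + \<Gamma>) P v"
  shows "((\<exists>U \<in> clarke_jacobian (KKT_residual f h g) (x, \<xi>, \<Gamma>). nonsingular U)
            \<longrightarrow> W_SRCQ h g x P v)
       \<and> (convex_NLSDP f h g
            \<and> (\<exists>U \<in> clarke_jacobian (KKT_residual f h g) (x, \<xi>, \<Gamma>). nonsingular U)
            \<longrightarrow> W_SRCQ h g x P v \<and> W_SOC f h g x \<xi> \<Gamma> P v)"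
proof -
  obtain f' f'' where f: "\<And>x. (f has_derivative blinfun_apply (f' x)) (at x)"
    "\<And>x. (f' has_derivative blinfun_apply (f'' x)) (at x)" "continuous_on UNIV f''"
    using assms(1) unfolding twice_continuously_differentiable_def by blast
  obtain h' h'' where h: "\<And>x. (h has_derivative blinfun_apply (h' x)) (at x)"
    "\<And>x. (h' has_derivative blinfun_apply (h'' x)) (at x)" "continuous_on UNIV h''"
    using assms(2) unfolding twice_continuously_differentiable_def by blast
  obtain g' g'' where g: "\<And>x. (g has_derivative blinfun_apply (g' x)) (at x)"
    "\<And>x. (g' has_derivative blinfun_apply (g'' x)) (at x)" "continuous_on UNIV g''"
    using assms(3) unfolding twice_continuously_differentiable_def by blast
  interpret nlsdp f f' f'' h h' h'' g g' g''
    by unfold_locales (fact f h g)+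
  have spec: "orthogonal_matrix P" "mat_of (g x + \<Gamma>) = P ** Diag v ** transpose P"
    using assms(6) by (auto simp: ordered_eigendecomposition_def)
  have "\<Gamma> \<in> normal_cone psd_cone (g x)"
    using assms(5) by (simp add: multipliers_def KKT_point_def)
  note \<Gamma> = normal_cone_psd_cone_nonpos[OF this]
  show ?thesis
    using nonsingular_imp_W_SRCQ[OF spec] nonsingular_imp_W_SOC[OF spec _ _ _ \<Gamma>] clarke_jacobian_subset
    unfolding nonsingular_def by blast
qed

end
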